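(* Consider the batch convex Q-learning recursion: $\theta_0\in\mathbb R^d$ is given and, for $n\ge0$, $$\theta_{n+1}=\operatorname*{arg\,min}_{\theta\in\mathbb R^d}\Bigl\{-\langle\mu,J^\theta\rangle+\kappa^{\varepsilon}_n\,\mathcal E^{\varepsilon}_n(\theta)+\kappa^+_n\,\mathcal E^+_n(\theta)+\frac1{\alpha_{n+1}}\frac12\|\theta-\theta_n\|^2\Bigr\},$$ $$\mathcal E^{\varepsilon}_n(\theta)=\frac1{r_n}\sum_{k=T_n}^{T_{n+1}-1}\bigl[-Q^\theta(x(k),u(k))+c(x(k),u(k))+J^\theta(x(k+1))\bigr]^2,$$ $$\mathcal E^+_n(\theta)=\frac1{r_n}\sum_{k=T_n}^{T_{n+1}-1}\bigl[\{J^\theta(x(k))-Q^\theta(x(k),u(k))\}_+\bigr]^2,$$ with $r_n=T_{n+1}-T_n$, where the data are generated as described in the context. Define the steady-state losses $$\bar{\mathcal E}^{\varepsilon}(\theta)=\mathsf E_\varpi\bigl[\{-Q^\theta(x(k),u(k))+c(x(k),u(k))+J^\theta(x(k+1))\}^2\bigr],$$ $$\bar{\mathcal E}^+(\theta)=\mathsf E_\varpi\bigl[\{J^\theta(x(k))-Q^\theta(x(k),u(k))\}_+^2\bigr].$$ Assume: (i) the parameterization $(J^\theta,Q^\theta)$ is linear, $J^\theta(x)=\theta^{\intercal}\psi^J(x)$ and $Q^\theta(x,u)=\theta^{\intercal}\psi(x,u)$, and $\bar{\mathcal E}^{\varepsilon}$ is strongly convex; (ii) the non-negative step-size sequence is of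 the form $\alpha_n=\alpha_1/n$, with $\alpha_1>0$; (iii) the parameters reach steady-state limits $r=\lim_{n}r_n$, $\kappa^{\varepsilon}=\lim_n\kappa^{\varepsilon}_n$ (with $\kappa^\varepsilon>0$), $\kappa^+=\lim_n\kappa^+_n$. Then the algorithm is consistent: $\theta_n\to\theta^*$ as $n\to\infty$, where the limit is the unique optimizer $$\theta^*=\operatorname*{arg\,min}_\theta\Bigl\{-\langle\mu,J^\theta\rangle+\kappa^{\varepsilon}\,\bar{\mathcal E}^{\varepsilon}(\theta)+\kappa^+\,\bar{\mathcal E}^+(\theta)\Bigr\}.$$
   Context: Control system and data. $\mathsf X,\mathsf U$ are Polish spaces; $x(k+1)=\mathrm F(x(k),u(k))$ with $\mathrm F:\mathsf X\times\mathsf U\to\mathsf X$; there is an equilibrium $x^e=\mathrm F(x^e,u^e)$; the cost $c:\mathsf X\times\mathsf U\to\mathbb R_+$ vanishes at $(x^e,u^e)$. The training input is $u(k)=\phi(x(k),\xi(k))$, where the exploration sequence $\xi(k)\in\mathbb R^p$ is bounded and satisfies $\xi(k+1)=\mathrm H(\xi(k))$, $\mathrm H:\mathbb R^p\to\mathbb R^p$. Let $\Phi(k)=(x(k),u(k),\xi(k))\in\mathsf Z=\mathsf X\times\mathsf U\times\mathbb R^p$. Standing assumption: $\mathrm F,\phi,\mathrm H$ are continuous, and $\{\Phi(k)\}$ is bounded and ergodic in the following sense. For continuous $g:\mathsf Z\to\mathbb R$ let $\bar g_N=\frac1N\sum_{k=1}^N g(\Phi(k))$. There is a unique probability measure $\varpi$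 on $\mathsf Z$, with compact support, such that for any continuous $g$ and each initial condition $\Phi(0)$ the limit $\mathsf E_\varpi[g(\Phi)]=\lim_{N\to\infty}\bar g_N$ exists; moreover, for each $L<\infty$, $\lim_{N\to\infty}\sup_{g\in\mathcal G_L}|\bar g_N-\mathsf E_\varpi[g(\Phi)]|=0$, where $\mathcal G_L=\{g:|g(z')-g(z)|\le L\|z-z'\|\text{ for all }z,z'\in\mathsf Z\}$. $\mathsf E_\varpi$ in the steady-state losses is this expectation, with $x(k+1)=\mathrm F(x(k),u(k))$. Algorithm data. $0=T_0<T_1<T_2<\cdots$ is an infinite sequence of integers; $\kappa^{\varepsilon}_n,\kappa^+_n$ are positive scalars; $\mu$ is a positive measure on $\mathsf X$ with $\langle\mu,J\rangle=\int J\,d\mu$; $\{s\}_+=\max(s,0)$. The functions $\psi^J:\mathsf X\to\mathbb R^d$, $\psi:\mathsf X\times\mathsf U\to\mathbb R^d$ and $c$ are continuous, with $\psi^J$ $\mu$-integrable, and $\psi^J(x^e)=0$. *)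

theory Defs
  imports "HOL-Probability.Probability"
begin

definition strongly_convex_on :: "'a::real_normed_vector set \<Rightarrow> ('a \<Rightarrow> real) \<Rightarrow> bool" where
  "strongly_convex_on S f \<longleftrightarrow> convex S \<and>
     (\<exists>m>0. \<forall>x\<in>S. \<forall>y\<in>S. \<forall>t\<in>{0..1}.
        f ((1 - t) *\<^sub>R x + t *\<^sub>R y)
          \<le> (1 - t) * f x + t * f y - m / 2 * t * (1 - t) * (norm (x - y))\<^sup>2)"

definition measure_support :: "'a::topological_space measure \<Rightarrow> 'a set" where
  "measure_support M = {z. \<forall>S. open S \<and> z \<in> S \<longrightarrow> emeasure M S > 0}"

definition closed_loop ::
  "('x \<times> 'u \<Rightarrow> 'x) \<Rightarrow> ('x \<times> (real^'p) \<Rightarrow> 'u) \<Rightarrow> (real^'p \<Rightarrow> real^'p) \<Rightarrow>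
   (nat \<Rightarrow> 'x) \<Rightarrow> (nat \<Rightarrow> 'u) \<Rightarrow> (nat \<Rightarrow> real^'p) \<Rightarrow> bool" where
  "closed_loop F \<phi> H x u \<xi> \<longleftrightarrow>
     (\<forall>k. x (Suc k) = F (x k, u k) \<and> u k = \<phi> (x k, \<xi> k) \<and> \<xi> (Suc k) = H (\<xi> k))"

definition joint_process ::
  "(nat \<Rightarrow> 'x) \<Rightarrow> (nat \<Rightarrow> 'u) \<Rightarrow> (nat \<Rightarrow> real^'p) \<Rightarrow> nat \<Rightarrow> 'x \<times> 'u \<times> (real^'p)" where
  "joint_process x u \<xi> k = (x k, u k, \<xi> k)"

definition empirical_mean :: "(nat \<Rightarrow> 'z) \<Rightarrow> ('z \<Rightarrow> real) \<Rightarrow> nat \<Rightarrow> real" where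
  "empirical_mean \<Phi> g N = (\<Sum>k=1..N. g (\<Phi> k)) / real N"

text \<open>Initial conditions \<open>\<Phi>(0)\<close> are ranged over by quantifying over all closed-loop trajectories.\<close>

definition ergodic_measure ::
  "('x::polish_space \<times> 'u::polish_space \<Rightarrow> 'x) \<Rightarrow> ('x \<times> (real^'p) \<Rightarrow> 'u) \<Rightarrow>
   (real^'p \<Rightarrow> real^'p) \<Rightarrow> ('x \<times> 'u \<times> (real^'p)) measure \<Rightarrow> bool" where
  "ergodic_measure F \<phi> H \<omega> \<longleftrightarrow>
     sets \<omega> = sets borel \<and> prob_space \<omega> \<and> compact (measure_support \<omega>) \<and>
     (\<forall>x u \<xi>. closed_loop F \<phi> H x u \<xi> \<longrightarrow>
        (\<forall>g. continuous_on UNIV g \<longrightarrow>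
           empirical_mean (joint_process x u \<xi>) g \<longlonglongrightarrow> (\<integral>z. g z \<partial>\<omega>)))"

text \<open>The supremum over the Lipschitz class is taken in \<open>ennreal\<close>, so that it is meaningful
  without a prior boundedness proof.\<close>

definition uniquely_ergodic ::
  "('x::polish_space \<times> 'u::polish_space \<Rightarrow> 'x) \<Rightarrow> ('x \<times> (real^'p) \<Rightarrow> 'u) \<Rightarrow>
   (real^'p \<Rightarrow> real^'p) \<Rightarrow> ('x \<times> 'u \<times> (real^'p)) measure \<Rightarrow> bool" where
  "uniquely_ergodic F \<phi> H \<omega> \<longleftrightarrow>
     ergodic_measure F \<phi> H \<omega> \<and>
     (\<forall>\<omega>'. ergodic_measure F \<phi> H \<omega>' \<longrightarrow> \<omega>' = \<omega>) \<and>
     (\<forall>x u \<xi>. closed_loop F \<phi> H x u \<xi> \<longrightarrow>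
        (\<forall>L\<ge>0.
           (\<lambda>N. SUP g\<in>{g. L-lipschitz_on UNIV g}.
              ennreal \<bar>empirical_mean (joint_process x u \<xi>) g N - (\<integral>z. g z \<partial>\<omega>)\<bar>)
           \<longlonglongrightarrow> 0))"

definition batch_bellman_loss ::
  "('t \<Rightarrow> 'x \<Rightarrow> real) \<Rightarrow> ('t \<Rightarrow> 'x \<times> 'u \<Rightarrow> real) \<Rightarrow> ('x \<times> 'u \<Rightarrow> real) \<Rightarrow>
   (nat \<Rightarrow> 'x) \<Rightarrow> (nat \<Rightarrow> 'u) \<Rightarrow> (nat \<Rightarrow> nat) \<Rightarrow> nat \<Rightarrow> 't \<Rightarrow> real" where
  "batch_bellman_loss J Q c x u T n \<theta> =
     1 / real (T (Suc n) - T n) *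
       (\<Sum>k = T n..<T (Suc n). (- Q \<theta> (x k, u k) + c (x k, u k) + J \<theta> (x (Suc k)))\<^sup>2)"

definition batch_constraint_loss ::
  "('t \<Rightarrow> 'x \<Rightarrow> real) \<Rightarrow> ('t \<Rightarrow> 'x \<times> 'u \<Rightarrow> real) \<Rightarrow>
   (nat \<Rightarrow> 'x) \<Rightarrow> (nat \<Rightarrow> 'u) \<Rightarrow> (nat \<Rightarrow> nat) \<Rightarrow> nat \<Rightarrow> 't \<Rightarrow> real" where
  "batch_constraint_loss J Q x u T n \<theta> =
     1 / real (T (Suc n) - T n) *
       (\<Sum>k = T n..<T (Suc n). (max (J \<theta> (x k) - Q \<theta> (x k, u k)) 0)\<^sup>2)"

text \<open>In steady state \<open>x(k+1)\<close> is \<open>F (x(k), u(k))\<close>, a function of \<open>\<Phi>(k)\<close>.\<close>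

definition mean_bellman_loss ::
  "('x::topological_space \<times> 'u::topological_space \<times> (real^'p)) measure \<Rightarrow> ('x \<times> 'u \<Rightarrow> 'x) \<Rightarrow>
   ('t \<Rightarrow> 'x \<Rightarrow> real) \<Rightarrow> ('t \<Rightarrow> 'x \<times> 'u \<Rightarrow> real) \<Rightarrow> ('x \<times> 'u \<Rightarrow> real) \<Rightarrow> 't \<Rightarrow> real" where
  "mean_bellman_loss \<omega> F J Q c \<theta> =
     (\<integral>(x, u, \<xi>). (- Q \<theta> (x, u) + c (x, u) + J \<theta> (F (x, u)))\<^sup>2 \<partial>\<omega>)"

definition mean_constraint_loss ::
  "('x::topological_space \<times> 'u::topological_space \<times> (real^'p)) measure \<Rightarrow>
   ('t \<Rightarrow> 'x \<Rightarrow> real) \<Rightarrow> ('t \<Rightarrow> 'x \<times> 'u \<Rightarrow> real) \<Rightarrow> 't \<Rightarrow> real" where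
  "mean_constraint_loss \<omega> J Q \<theta> =
     (\<integral>(x, u, \<xi>). (max (J \<theta> x - Q \<theta> (x, u)) 0)\<^sup>2 \<partial>\<omega>)"

definition batch_objective ::
  "'x measure \<Rightarrow> ('t::real_normed_vector \<Rightarrow> 'x \<Rightarrow> real) \<Rightarrow> ('t \<Rightarrow> 'x \<times> 'u \<Rightarrow> real) \<Rightarrow>
   ('x \<times> 'u \<Rightarrow> real) \<Rightarrow> (nat \<Rightarrow> 'x) \<Rightarrow> (nat \<Rightarrow> 'u) \<Rightarrow> (nat \<Rightarrow> nat) \<Rightarrow>
   (nat \<Rightarrow> real) \<Rightarrow> (nat \<Rightarrow> real) \<Rightarrow> (nat \<Rightarrow> real) \<Rightarrow> nat \<Rightarrow> 't \<Rightarrow> 't \<Rightarrow> real" where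
  "batch_objective \<mu> J Q c x u T \<kappa>\<epsilon> \<kappa>p \<alpha> n \<theta>\<^sub>n \<theta> =
     - (\<integral>y. J \<theta> y \<partial>\<mu>)
     + \<kappa>\<epsilon> n * batch_bellman_loss J Q c x u T n \<theta>
     + \<kappa>p n * batch_constraint_loss J Q x u T n \<theta>
     + 1 / \<alpha> (Suc n) * (1 / 2 * (norm (\<theta> - \<theta>\<^sub>n))\<^sup>2)"

definition limit_objective ::
  "'x measure \<Rightarrow> ('x::topological_space \<times> 'u::topological_space \<times> (real^'p)) measure \<Rightarrow>
   ('x \<times> 'u \<Rightarrow> 'x) \<Rightarrow> ('t \<Rightarrow> 'x \<Rightarrow> real) \<Rightarrow> ('t \<Rightarrow> 'x \<times> 'u \<Rightarrow> real) \<Rightarrow>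
   ('x \<times> 'u \<Rightarrow> real) \<Rightarrow> real \<Rightarrow> real \<Rightarrow> 't \<Rightarrow> real" where
  "limit_objective \<mu> \<omega> F J Q c \<kappa>\<epsilon> \<kappa>p \<theta> =
     - (\<integral>y. J \<theta> y \<partial>\<mu>)
     + \<kappa>\<epsilon> * mean_bellman_loss \<omega> F J Q c \<theta>
     + \<kappa>p * mean_constraint_loss \<omega> J Q \<theta>"

end

theory Submission
  imports Defs
begin

text \<open>The objective minimized in step \<open>n\<close> is a convex differentiable function \<open>f\<^sub>n\<close> plus a proximal
term, so the recursion is the implicit gradient step
\<open>\<theta>\<^sub>n\<^sub>+\<^sub>1 = \<theta>\<^sub>n - (a / (n + 1)) \<nabla>f\<^sub>n (\<theta>\<^sub>n\<^sub>+\<^sub>1)\<close> with \<open>a = \<alpha>\<^sub>1\<close>. A single \<open>f\<^sub>n\<close> sees one batch and may be far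
from the limit objective \<open>f\<close>; only the averages \<open>(f\<^sub>0 + \<dots> + f\<^sub>n\<^sub>-\<^sub>1) / n\<close> converge to \<open>f\<close>. What makes the
iteration work is that the step sizes \<open>a / n\<close> fit this averaging.

Let \<open>\<theta>\<^sup>*\<close> be the minimizer of \<open>f\<close>, put \<open>d\<^sub>n = f\<^sub>n - f\<^sub>n (\<theta>\<^sup>*)\<close> and \<open>d = f - f (\<theta>\<^sup>*)\<close>, and let \<open>e\<^sub>n\<close> be the
deviation of \<open>(d\<^sub>0 + \<dots> + d\<^sub>n\<^sub>-\<^sub>1) / n\<close> from \<open>d\<close>. Then \<open>d\<^sub>n = d + (n + 1) e\<^sub>n\<^sub>+\<^sub>1 - n e\<^sub>n\<close>, that is,
\<open>(a / (n + 1)) d\<^sub>n = (a / (n + 1)) (d + e\<^sub>n) + a (e\<^sub>n\<^sub>+\<^sub>1 - e\<^sub>n)\<close>. Convexity of \<open>f\<^sub>n\<close> gives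
\<open>\<bar>\<theta>\<^sub>n\<^sub>+\<^sub>1 - \<theta>\<^sup>*\<bar>\<^sup>2 \<le> \<bar>\<theta>\<^sub>n - \<theta>\<^sup>*\<bar>\<^sup>2 - 2 (a / (n + 1)) d\<^sub>n (\<theta>\<^sub>n\<^sub>+\<^sub>1)\<close>, and in the corrected Lyapunov function
\<open>W\<^sub>n = \<bar>\<theta>\<^sub>n - \<theta>\<^sup>*\<bar>\<^sup>2 + 2 a e\<^sub>n (\<theta>\<^sub>n)\<close> the difference \<open>e\<^sub>n\<^sub>+\<^sub>1 - e\<^sub>n\<close> telescopes. There remain the decrease
from \<open>d (\<theta>\<^sub>n\<^sub>+\<^sub>1) \<ge> m \<bar>\<theta>\<^sub>n\<^sub>+\<^sub>1 - \<theta>\<^sup>*\<bar>\<^sup>2\<close> and the error \<open>e\<^sub>n (\<theta>\<^sub>n\<^sub>+\<^sub>1) - e\<^sub>n (\<theta>\<^sub>n)\<close>, a small Lipschitz constant times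
a step of order \<open>1 / n\<close>. So \<open>W\<^sub>n\<^sub>+\<^sub>1 \<le> W\<^sub>n + (\<epsilon> - c W\<^sub>n\<^sub>+\<^sub>1) / (n + 1)\<close> eventually, for every \<open>\<epsilon> > 0\<close>, which
forces \<open>W\<^sub>n\<close> below every positive bound because the harmonic series diverges. This is
\<open>incremental_proximal_convergence\<close>. Since nothing bounds \<open>\<theta>\<^sub>n\<close> in advance, all errors are measured relative
to \<open>1 + \<bar>\<theta>\<bar>\<close>.

That the Lipschitz constant of \<open>e\<^sub>n\<close> tends to zero in this relative sense means that the averaged
gradients converge uniformly. Each sample loss has the form \<open>p (\<theta> \<bullet> v + c)\<close>, where \<open>p (s)\<close> is \<open>s\<^sup>2\<close> or
\<open>{s}\<^sub>+\<^sup>2\<close>, and the slope \<open>p'\<close> is positively homogeneous. Hence the sample gradient \<open>p' (\<theta> \<bullet> v + s c) v\<close>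
is positively homogeneous in \<open>(\<theta>, s)\<close>, and pointwise convergence together with a common Lipschitz
constant gives uniform convergence on the compact unit sphere (\<open>batch_grad_averages\<close>).

Ergodicity enters through limits of averages along the given trajectory. A bounded set of a
Polish space need not be relatively compact, so the bounds on \<open>v\<close> and \<open>c\<close> along the data come from the
law of large numbers instead: it holds for all continuous functions, however fast they grow, and
this is impossible along a trajectory on which a continuous function is unbounded
(\<open>bounded_if_all_means_converge\<close>). As the batch lengths converge, averages over batches have the
same limits as averages over samples (\<open>cesaro_batch_mean\<close>).\<close>

section \<open>Cesaro means and means over batches\<close>

definition cesaro :: "(nat \<Rightarrow> 'a::real_normed_vector) \<Rightarrow> nat \<Rightarrow> 'a" where
  "cesaro y N = (\<Sum>k<N. y k) /\<^sub>R real N"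

lemma cesaro_add: "cesaro (\<lambda>k. y k + z k) N = cesaro y N + cesaro z N"
  by (simp add: cesaro_def sum.distrib scaleR_right_distrib)

lemma cesaro_diff: "cesaro (\<lambda>k. y k - z k) N = cesaro y N - cesaro z N"
  by (simp add: cesaro_def sum_subtractf scaleR_right_diff_distrib)

lemma cesaro_scaleR: "cesaro (\<lambda>k. a *\<^sub>R y k) N = a *\<^sub>R cesaro y N"
  by (simp add: cesaro_def scaleR_sum_right[symmetric])

lemma cesaro_inner: "cesaro y N \<bullet> b = cesaro (\<lambda>k. y k \<bullet> b) N"
  by (simp add: cesaro_def inner_sum_left)

lemma cesaro_const: "N > 0 \<Longrightarrow> cesaro (\<lambda>_. a) N = a"
  by (simp add: cesaro_def scaleR_conv_of_real sum_constant_scaleR)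

lemma norm_cesaro_le:
  assumes "\<And>k. norm (y k) \<le> B"
  shows "norm (cesaro y N) \<le> B"
proof (cases "N = 0")
  case True
  then show ?thesis using order_trans[OF norm_ge_zero assms[of 0]] by (simp add: cesaro_def)
next
  case False
  have "norm (\<Sum>k<N. y k) \<le> real N * B"
    using sum_norm_bound[of "{..<N}" y B] assms by simp
  then show ?thesis using False by (simp add: cesaro_def divide_simps mult.commute)
qed

lemma cesaro_null:
  fixes y :: "nat \<Rightarrow> 'a::real_normed_vector"
  assumes "y \<longlonglongrightarrow> 0"
  shows "cesaro y \<longlonglongrightarrow> 0"
proof (rule LIMSEQ_I)
  fix e :: real assume e: "e > 0"
  obtain M where M: "\<And>k. k \<ge> M \<Longrightarrow> norm (y k) < e / 2"
    using LIMSEQ_D[OF assms, of "e / 2"] e by auto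
  define C where "C = (\<Sum>k<M. norm (y k))"
  obtain N0 :: nat where N0: "real N0 > 2 * C / e" using reals_Archimedean2 by blast
  show "\<exists>no. \<forall>N\<ge>no. norm (cesaro y N - 0) < e"
  proof (intro exI allI impI)
    fix N assume N: "N \<ge> max (Suc N0) M"
    have "norm (\<Sum>k<N. y k) \<le> (\<Sum>k<N. norm (y k))" by (rule norm_sum)
    also have "\<dots> = C + (\<Sum>k\<in>{M..<N}. norm (y k))"
      using N unfolding C_def by (subst sum.atLeastLessThan_concat[of 0 M N, symmetric, unfolded atLeast0LessThan]) auto
    also have "(\<Sum>k\<in>{M..<N}. norm (y k)) \<le> real (card {M..<N}) * (e / 2)"
      by (rule sum_bounded_above) (use M in \<open>auto intro: less_imp_le\<close>)
    also have "\<dots> \<le> real N * (e / 2)" using e by (intro mult_right_mono) auto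
    also have "C < real N * (e / 2)"
      using N N0 e by (simp add: divide_simps) (smt (verit) mult_left_mono of_nat_le_iff mult.commute Suc_leD)
    finally have "norm (\<Sum>k<N. y k) < real N * e" by (simp add: field_simps)
    then show "norm (cesaro y N - 0) < e" using N by (simp add: cesaro_def field_simps)
  qed
qed

lemma cesaro_tendsto:
  assumes "y \<longlonglongrightarrow> l"
  shows "cesaro y \<longlonglongrightarrow> l"
proof -
  have "cesaro (\<lambda>k. y k - l) \<longlonglongrightarrow> 0" by (rule cesaro_null) (use assms LIM_zero in blast)
  moreover have "\<forall>\<^sub>F N in sequentially. cesaro (\<lambda>k. y k - l) N = cesaro y N - l"
    using eventually_gt_at_top[of 0] by eventually_elim (simp add: cesaro_diff cesaro_const)
  ultimately have "(\<lambda>N. cesaro y N - l) \<longlonglongrightarrow> 0" by (simp add: tendsto_cong)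
  then show ?thesis by (rule LIM_zero_cancel)
qed

lemma cesaro_weighted:
  fixes D :: "nat \<Rightarrow> 'a::real_normed_vector" and c :: "nat \<Rightarrow> real"
  assumes c: "c \<longlonglongrightarrow> c'" and D: "\<And>n. norm (D n) \<le> B" and l: "cesaro D \<longlonglongrightarrow> l"
  shows "cesaro (\<lambda>n. c n *\<^sub>R D n) \<longlonglongrightarrow> c' *\<^sub>R l"
proof -
  have "(\<lambda>n. (c n - c') *\<^sub>R D n) \<longlonglongrightarrow> 0"
  proof (rule tendsto_0_le[where K = B])
    show "(\<lambda>n. c n - c') \<longlonglongrightarrow> 0" using c LIM_zero by blast
    show "\<forall>\<^sub>F n in sequentially. norm ((c n - c') *\<^sub>R D n) \<le> norm (c n - c') * B"
      using D by (auto intro!: always_eventually mult_left_mono)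
  qed
  then have "(\<lambda>N. cesaro (\<lambda>n. (c n - c') *\<^sub>R D n) N + c' *\<^sub>R cesaro D N) \<longlonglongrightarrow> 0 + c' *\<^sub>R l"
    by (intro tendsto_intros cesaro_null l)
  then show ?thesis
    by (simp add: cesaro_scaleR[symmetric] cesaro_add[symmetric] scaleR_left_diff_distrib)
qed

definition batch_mean :: "(nat \<Rightarrow> nat) \<Rightarrow> (nat \<Rightarrow> 'a::real_normed_vector) \<Rightarrow> nat \<Rightarrow> 'a" where
  "batch_mean T y n = (\<Sum>k = T n..<T (Suc n). y k) /\<^sub>R real (T (Suc n) - T n)"

lemma batch_mean_scaleR: "batch_mean T (\<lambda>k. a *\<^sub>R y k) n = a *\<^sub>R batch_mean T y n"
  by (simp add: batch_mean_def scaleR_sum_right[symmetric])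

lemma batch_mean_diff: "batch_mean T (\<lambda>k. y k - z k) n = batch_mean T y n - batch_mean T z n"
  by (simp add: batch_mean_def sum_subtractf scaleR_right_diff_distrib)

lemma norm_batch_mean_le:
  assumes "strict_mono T" "\<And>k. norm (y k) \<le> B"
  shows "norm (batch_mean T y n) \<le> B"
proof -
  have "T n < T (Suc n)" using assms(1) by (simp add: strict_mono_Suc_iff)
  moreover have "norm (\<Sum>k = T n..<T (Suc n). y k) \<le> real (T (Suc n) - T n) * B"
    using sum_norm_bound[of "{T n..<T (Suc n)}" y B] assms(2) by simp
  ultimately show ?thesis by (simp add: batch_mean_def divide_simps mult.commute)
qed

lemma sum_batches:
  fixes y :: "nat \<Rightarrow> 'a::comm_monoid_add"
  assumes "T 0 = 0" "strict_mono T"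
  shows "(\<Sum>n<N. \<Sum>k = T n..<T (Suc n). y k) = (\<Sum>k<T N. y k)"
proof (induction N)
  case (Suc N)
  have "T N \<le> T (Suc N)" using assms(2) by (simp add: strict_mono_less_eq)
  then show ?case
    using Suc sum.atLeastLessThan_concat[of 0 "T N" "T (Suc N)" y] by (simp add: atLeast0LessThan)
qed (simp add: assms)

text \<open>The batch sums telescope to the partial sums of \<open>y\<close> at the times \<open>T N\<close>, and \<open>T N / N\<close>, which is the
Cesaro mean of the batch lengths, tends to \<open>r\<close>. So the batch sums average to \<open>r l\<close>, and the
convergent weights \<open>\<kappa> n / r\<^sub>n\<close> may be replaced by their limit because the batch sums are bounded.\<close>

lemma cesaro_batch_mean:
  fixes y :: "nat \<Rightarrow> 'a::real_normed_vector"
  assumes T: "T 0 = 0" "strict_mono T"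
    and r: "(\<lambda>n. real (T (Suc n) - T n)) \<longlonglongrightarrow> r"
    and \<kappa>: "\<kappa> \<longlonglongrightarrow> \<kappa>'"
    and y: "\<And>k. norm (y k) \<le> B" and l: "cesaro y \<longlonglongrightarrow> l"
  shows "cesaro (\<lambda>n. \<kappa> n *\<^sub>R batch_mean T y n) \<longlonglongrightarrow> \<kappa>' *\<^sub>R l"
proof -
  define D where "D n = (\<Sum>k = T n..<T (Suc n). y k)" for n
  have T_less: "T n < T (Suc n)" for n using T(2) by (simp add: strict_mono_Suc_iff)
  have "1 \<le> r"
    by (rule LIMSEQ_le_const[OF r]) (use T_less in \<open>auto simp: Suc_le_eq intro!: exI[of _ 0]\<close>)
  obtain R where R: "\<And>n. real (T (Suc n) - T n) \<le> R"
    using convergent_imp_Bseq[of "\<lambda>n. real (T (Suc n) - T n)"] r unfolding convergent_def Bseq_def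
    by auto
  have "B \<ge> 0" using norm_ge_zero[of "y 0"] y[of 0] by linarith
  have D_bound: "norm (D n) \<le> R * B" for n
  proof -
    have "norm (D n) \<le> real (T (Suc n) - T n) * B"
      using sum_norm_bound[of "{T n..<T (Suc n)}" y B] y by (simp add: D_def)
    also have "\<dots> \<le> R * B" using R \<open>B \<ge> 0\<close> by (intro mult_right_mono) auto
    finally show ?thesis .
  qed
  have mean_T: "(\<lambda>N. real (T N) / real N) \<longlonglongrightarrow> r"
  proof -
    have "cesaro (\<lambda>n. real (T (Suc n) - T n)) N = real (T N) / real N" for N
    proof -
      have "(\<Sum>n<N. real (T (Suc n) - T n)) = real (T N)"
        using sum_batches[OF T, of "\<lambda>_. 1::real" N] by simp
      then show ?thesis by (simp add: cesaro_def divide_inverse mult.commute)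
    qed
    then show ?thesis using cesaro_tendsto[OF r] by presburger
  qed
  have "cesaro D = (\<lambda>N. (real (T N) / real N) *\<^sub>R cesaro y (T N))"
  proof
    fix N show "cesaro D N = (real (T N) / real N) *\<^sub>R cesaro y (T N)"
    proof (cases "N = 0")
      case False
      then have "T N > 0" using T strict_mono_less[OF T(2), of 0 N] by simp
      then show ?thesis
        unfolding cesaro_def D_def sum_batches[OF T] by (simp add: divide_inverse)
    qed (simp add: cesaro_def)
  qed
  moreover have "(\<lambda>N. cesaro y (T N)) \<longlonglongrightarrow> l"
    using l LIMSEQ_subseq_LIMSEQ[OF l T(2)] by (simp add: o_def)
  ultimately have "cesaro D \<longlonglongrightarrow> r *\<^sub>R l"
    using mean_T by (simp add: tendsto_scaleR)
  then have lim: "cesaro (\<lambda>n. (\<kappa> n / real (T (Suc n) - T n)) *\<^sub>R D n) \<longlonglongrightarrow> (\<kappa>' / r) *\<^sub>R r *\<^sub>R l"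
    using \<open>1 \<le> r\<close> by (intro cesaro_weighted[OF _ D_bound] tendsto_divide \<kappa> r) auto
  have "(\<kappa>' / r) *\<^sub>R r *\<^sub>R l = \<kappa>' *\<^sub>R l" using \<open>1 \<le> r\<close> by simp
  from lim[unfolded this] show ?thesis by (simp add: batch_mean_def D_def divide_inverse)
qed

section \<open>Observables along an ergodic trajectory\<close>

text \<open>A locally finite sum of ramps, the \<open>n\<close>-th one starting at \<open>n\<close> with slope \<open>a n\<close>.\<close>

lemma continuous_eventually_above:
  fixes a :: "nat \<Rightarrow> real"
  assumes "\<And>n. a n \<ge> 0"
  shows "\<exists>q :: real \<Rightarrow> real. continuous_on UNIV q \<and> (\<forall>n t. t \<ge> real (Suc n) \<longrightarrow> q t \<ge> a n)"
proof -
  define q where "q t = (\<Sum>j<nat \<lceil>t\<rceil>. max 0 (t - real j) * a j)" for t :: real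
  have q_eq: "q t = (\<Sum>j<M. max 0 (t - real j) * a j)" if "t < real M" for t M
  proof -
    have "nat \<lceil>t\<rceil> \<le> M" using that by linarith
    moreover have "max 0 (t - real j) = 0" if "j \<notin> {..<nat \<lceil>t\<rceil>}" for j using that by (simp, linarith)
    ultimately show ?thesis unfolding q_def by (intro sum.mono_neutral_left) auto
  qed
  have "isCont q t" for t
  proof -
    obtain M :: nat where M: "t < real M" using reals_Archimedean2 by blast
    have "isCont (\<lambda>t. \<Sum>j<M. max 0 (t - real j) * a j) t" by (intro continuous_intros)
    moreover have "\<forall>\<^sub>F s in nhds t. q s = (\<Sum>j<M. max 0 (s - real j) * a j)"
      using eventually_nhds_in_open[of "{..<real M}" t] M by (auto elim!: eventually_mono dest: q_eq)
    ultimately show ?thesis by (simp add: isCont_cong)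
  qed
  moreover have "q t \<ge> a n" if "t \<ge> real (Suc n)" for n t
  proof -
    have "a n \<le> max 0 (t - real n) * a n" using assms[of n] that by (simp add: mult_le_cancel_right1)
    also have "\<dots> \<le> q t" unfolding q_def using that assms
      by (intro member_le_sum) (auto, linarith)
    finally show ?thesis .
  qed
  ultimately show ?thesis by (intro exI[of _ q]) (auto simp: continuous_on_eq_continuous_at)
qed

text \<open>If the averages of \<open>q (y k)\<close> converge, then \<open>q (y k) / k\<close> tends to zero. If \<open>y\<close> were unbounded, it would
exceed \<open>n + 1\<close> in absolute value at some time \<open>\<tau> n\<close>, and a continuous \<open>q\<close> that is at least \<open>\<tau> n\<close> beyond
\<open>n + 1\<close> would give \<open>q (\<bar>y (\<tau> n)\<bar>) / \<tau> n \<ge> 1\<close> for unboundedly large times.\<close>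

lemma bounded_if_all_means_converge:
  fixes y :: "nat \<Rightarrow> real"
  assumes "\<And>q :: real \<Rightarrow> real. continuous_on UNIV q \<Longrightarrow>
      convergent (\<lambda>N. (\<Sum>k=1..N. q (y k)) / real N)"
  shows "bounded (range y)"
proof (rule ccontr)
  assume "\<not> bounded (range y)"
  then have "\<exists>k. \<bar>y k\<bar> \<ge> real (Suc n)" for n :: nat
    unfolding bounded_iff by (auto simp: not_le intro: less_imp_le)
  then obtain \<tau> where \<tau>: "\<And>n. \<bar>y (\<tau> n)\<bar> \<ge> real (Suc n)" by metis
  obtain q where q: "continuous_on UNIV q" "\<And>n t. t \<ge> real (Suc n) \<Longrightarrow> q t \<ge> real (\<tau> n)"
    using continuous_eventually_above[of "\<lambda>n. real (\<tau> n)"] by auto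
  define S where "S N = (\<Sum>k=1..N. q \<bar>y k\<bar>)" for N
  have "continuous_on UNIV (\<lambda>t. q \<bar>t\<bar>)"
    by (intro continuous_on_compose2[OF q(1)] continuous_intros) auto
  then obtain L where L: "(\<lambda>N. S N / real N) \<longlonglongrightarrow> L"
    using assms[of "\<lambda>t. q \<bar>t\<bar>"] by (auto simp: convergent_def S_def)
  \<comment> \<open>The last summand is recovered from two consecutive averages.\<close>
  have "(\<lambda>N. S (Suc N) / real (Suc N) - S N / real N * (real N / real (Suc N))) \<longlonglongrightarrow> L - L * 1"
    by (intro tendsto_intros L LIMSEQ_Suc[OF L] LIMSEQ_n_over_Suc_n)
  moreover have "S (Suc N) / real (Suc N) - S N / real N * (real N / real (Suc N))
      = q \<bar>y (Suc N)\<bar> / real (Suc N)" for N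
    by (cases "N = 0") (simp_all add: S_def divide_simps)
  ultimately have "(\<lambda>N. q \<bar>y (Suc N)\<bar> / real (Suc N)) \<longlonglongrightarrow> 0" by simp
  then have "\<forall>\<^sub>F N in sequentially. q \<bar>y (Suc N)\<bar> / real (Suc N) < 1"
    by (rule order_tendstoD) simp
  then obtain K where K: "\<And>N. N \<ge> K \<Longrightarrow> q \<bar>y (Suc N)\<bar> < real (Suc N)"
    by (auto simp: eventually_sequentially)
  have small: "\<tau> n \<le> K" for n
  proof (rule ccontr)
    assume "\<not> \<tau> n \<le> K"
    then obtain N where "\<tau> n = Suc N" "N \<ge> K" by (cases "\<tau> n") auto
    then show False using K[of N] q(2)[OF \<tau>[of n]] by simp
  qed
  obtain n :: nat where n: "real n > (\<Sum>k\<le>K. \<bar>y k\<bar>)" using reals_Archimedean2 by blast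
  have "\<bar>y (\<tau> n)\<bar> \<le> (\<Sum>k\<le>K. \<bar>y k\<bar>)" using small by (intro member_le_sum) auto
  then show False using n \<tau>[of n] by simp
qed

text \<open>Ergodic averages run over \<open>1, \<dots>, N\<close>, batches over \<open>0, \<dots>, N - 1\<close>; for bounded sequences the
two boundary terms vanish in the limit.\<close>

lemma cesaro_of_shifted_means:
  fixes y :: "nat \<Rightarrow> real"
  assumes "bounded (range y)" "(\<lambda>N. (\<Sum>k=1..N. y k) / real N) \<longlonglongrightarrow> l"
  shows "cesaro y \<longlonglongrightarrow> l"
proof -
  obtain B where B: "\<And>k. \<bar>y k\<bar> \<le> B" using assms(1) by (auto simp: bounded_iff)
  have "(\<lambda>N. (y 0 - y N) / real N) \<longlonglongrightarrow> 0"
  proof (rule Lim_null_comparison)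
    show "\<forall>\<^sub>F N in sequentially. norm ((y 0 - y N) / real N) \<le> 2 * B / real N"
    proof (intro always_eventually allI)
      fix N
      have "\<bar>y 0 - y N\<bar> \<le> 2 * B" using B[of 0] B[of N] by linarith
      then show "norm ((y 0 - y N) / real N) \<le> 2 * B / real N" by (simp add: divide_right_mono)
    qed
    show "(\<lambda>N. 2 * B / real N) \<longlonglongrightarrow> 0" by (rule lim_const_over_n)
  qed
  from tendsto_add[OF assms(2) this]
  have "(\<lambda>N. (\<Sum>k=1..N. y k) / real N + (y 0 - y N) / real N) \<longlonglongrightarrow> l" by simp
  moreover have "(\<Sum>k=1..N. y k) / real N + (y 0 - y N) / real N = cesaro y N" for N
  proof -
    have "(\<Sum>k<N. y k) = (\<Sum>k=1..N. y k) + (y 0 - y N)" by (induction N) auto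
    then show ?thesis by (simp only: cesaro_def divide_inverse scaleR_conv_of_real of_real_eq_id id_apply distrib_right mult.commute[of "inverse _"])
  qed
  ultimately show ?thesis by simp
qed

lemma ergodic_observable_bounded:
  fixes \<Phi> :: "nat \<Rightarrow> 'z::topological_space" and h :: "'z \<Rightarrow> 'b::real_normed_vector"
  assumes erg: "\<And>g :: 'z \<Rightarrow> real. continuous_on UNIV g \<Longrightarrow> empirical_mean \<Phi> g \<longlonglongrightarrow> I g"
    and h: "continuous_on UNIV h"
  obtains B where "\<And>k. norm (h (\<Phi> k)) \<le> B"
proof -
  have "bounded (range (\<lambda>k. norm (h (\<Phi> k))))"
  proof (rule bounded_if_all_means_converge)
    fix q :: "real \<Rightarrow> real" assume q: "continuous_on UNIV q"
    have "continuous_on UNIV (\<lambda>z. q (norm (h z)))"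
      by (intro continuous_on_compose2[OF q] continuous_intros h) auto
    from erg[OF this]
    show "convergent (\<lambda>N. (\<Sum>k=1..N. q (norm (h (\<Phi> k)))) / real N)"
      by (auto simp: convergent_def empirical_mean_def[abs_def])
  qed
  then obtain B where "\<And>k. norm (norm (h (\<Phi> k))) \<le> B" unfolding bounded_iff by blast
  then show ?thesis using that[of B] by simp
qed

lemma ergodic_cesaro_real:
  fixes \<Phi> :: "nat \<Rightarrow> 'z::topological_space" and h :: "'z \<Rightarrow> real"
  assumes erg: "\<And>g :: 'z \<Rightarrow> real. continuous_on UNIV g \<Longrightarrow> empirical_mean \<Phi> g \<longlonglongrightarrow> I g"
    and h: "continuous_on UNIV h"
  shows "cesaro (\<lambda>k. h (\<Phi> k)) \<longlonglongrightarrow> I h"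
proof (rule cesaro_of_shifted_means)
  show "bounded (range (\<lambda>k. h (\<Phi> k)))"
  proof -
    obtain B where "\<And>k. norm (h (\<Phi> k)) \<le> B" using ergodic_observable_bounded[OF erg h] by blast
    then show ?thesis unfolding bounded_iff by blast
  qed
  show "(\<lambda>N. (\<Sum>k=1..N. h (\<Phi> k)) / real N) \<longlonglongrightarrow> I h"
    using erg[OF h] by (simp add: empirical_mean_def[abs_def])
qed

lemma ergodic_cesaro_convergent:
  fixes \<Phi> :: "nat \<Rightarrow> 'z::topological_space" and h :: "'z \<Rightarrow> 'b::euclidean_space"
  assumes erg: "\<And>g :: 'z \<Rightarrow> real. continuous_on UNIV g \<Longrightarrow> empirical_mean \<Phi> g \<longlonglongrightarrow> I g"
    and h: "continuous_on UNIV h"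
  shows "\<exists>l. cesaro (\<lambda>k. h (\<Phi> k)) \<longlonglongrightarrow> l"
proof
  show "cesaro (\<lambda>k. h (\<Phi> k)) \<longlonglongrightarrow> (\<Sum>b\<in>Basis. I (\<lambda>z. h z \<bullet> b) *\<^sub>R b)"
  proof (subst tendsto_componentwise_iff, intro ballI)
    fix b :: 'b assume b: "b \<in> Basis"
    have "continuous_on UNIV (\<lambda>z. h z \<bullet> b)" by (intro continuous_intros h)
    from ergodic_cesaro_real[OF erg this]
    show "(\<lambda>N. cesaro (\<lambda>k. h (\<Phi> k)) N \<bullet> b) \<longlonglongrightarrow> (\<Sum>b\<in>Basis. I (\<lambda>z. h z \<bullet> b) *\<^sub>R b) \<bullet> b"
      using b by (simp add: cesaro_inner)
  qed
qed

section \<open>The incremental proximal iteration with harmonic step sizes\<close>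

text \<open>The limit \<open>fbar\<close> is only a pointwise limit, not known to be differentiable. The mean value theorem is
therefore applied to the difference of two averages \<open>N\<close> and \<open>M\<close>, whose gradient is small for large \<open>N\<close> and
\<open>M\<close>, and \<open>M\<close> is sent to infinity afterwards.\<close>

lemma averaged_deviation_lipschitz:
  fixes f :: "nat \<Rightarrow> 'a::euclidean_space \<Rightarrow> real" and g :: "nat \<Rightarrow> 'a \<Rightarrow> 'a"
  assumes deriv: "\<And>n x. (f n has_derivative (\<lambda>h. g n x \<bullet> h)) (at x)"
    and grad: "\<And>\<delta>. \<delta> > 0 \<Longrightarrow>
      \<forall>\<^sub>F N in sequentially. \<forall>x. norm (cesaro (\<lambda>n. g n x) N - gbar x) \<le> \<delta> * (1 + norm x)"
    and val: "\<And>x. cesaro (\<lambda>n. f n x) \<longlonglongrightarrow> fbar x"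
    and "\<delta> > 0"
  shows "\<forall>\<^sub>F N in sequentially. \<forall>x y.
      \<bar>(cesaro (\<lambda>n. f n x) N - fbar x) - (cesaro (\<lambda>n. f n y) N - fbar y)\<bar>
        \<le> \<delta> * (1 + norm x + norm y) * norm (x - y)"
proof -
  obtain K where K: "\<And>N x. N \<ge> K \<Longrightarrow> norm (cesaro (\<lambda>n. g n x) N - gbar x) \<le> \<delta> / 2 * (1 + norm x)"
    using grad[of "\<delta> / 2"] \<open>\<delta> > 0\<close> by (auto simp: eventually_sequentially)
  have "\<bar>(cesaro (\<lambda>n. f n x) N - fbar x) - (cesaro (\<lambda>n. f n y) N - fbar y)\<bar>
        \<le> \<delta> * (1 + norm x + norm y) * norm (x - y)" if N: "N \<ge> K" for N x y
  proof -
    have *: "\<bar>(cesaro (\<lambda>n. f n x) N - cesaro (\<lambda>n. f n x) M) - (cesaro (\<lambda>n. f n y) N - cesaro (\<lambda>n. f n y) M)\<bar>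
        \<le> \<delta> * (1 + norm x + norm y) * norm (x - y)" if M: "M \<ge> K" for M
    proof -
      let ?h = "\<lambda>z. cesaro (\<lambda>n. f n z) N - cesaro (\<lambda>n. f n z) M"
      let ?k = "\<lambda>z. cesaro (\<lambda>n. g n z) N - cesaro (\<lambda>n. g n z) M"
      have "norm (?h x - ?h y) \<le> (\<delta> * (1 + norm x + norm y)) * norm (x - y)"
      proof (rule differentiable_bound[where S = "closed_segment x y" and f' = "\<lambda>z h. ?k z \<bullet> h"])
        fix z assume z: "z \<in> closed_segment x y"
        have "((\<lambda>z. cesaro (\<lambda>n. f n z) P) has_derivative (\<lambda>h. cesaro (\<lambda>n. g n z) P \<bullet> h)) (at z)" for P
          unfolding cesaro_def by (auto intro!: derivative_eq_intros deriv simp: inner_sum_left)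
        then have "(?h has_derivative (\<lambda>h. ?k z \<bullet> h)) (at z)"
          by (auto intro!: derivative_eq_intros simp: inner_diff_left)
        then show "(?h has_derivative (\<lambda>h. ?k z \<bullet> h)) (at z within closed_segment x y)"
          by (rule has_derivative_at_withinI)
        have "norm z \<le> norm x + norm y"
        proof -
          obtain t where "0 \<le> t" "t \<le> 1" "z = (1 - t) *\<^sub>R x + t *\<^sub>R y"
            using z by (auto simp: in_segment)
          then have "norm z \<le> (1 - t) * norm x + t * norm y"
            by (metis abs_of_nonneg diff_ge_0_iff_ge norm_scaleR norm_triangle_ineq)
          also have "\<dots> \<le> 1 * norm x + 1 * norm y"
            using \<open>0 \<le> t\<close> \<open>t \<le> 1\<close> by (intro add_mono mult_right_mono) auto
          finally show ?thesis by simp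
        qed
        then have z': "\<delta> / 2 * (1 + norm z) \<le> \<delta> / 2 * (1 + norm x + norm y)"
          using \<open>\<delta> > 0\<close> by (intro mult_left_mono) auto
        have "norm (?k z) \<le> norm (cesaro (\<lambda>n. g n z) N - gbar z) + norm (cesaro (\<lambda>n. g n z) M - gbar z)"
          by norm
        also have "\<dots> \<le> \<delta> * (1 + norm x + norm y)"
          using K[OF N, of z] K[OF M, of z] z' by argo
        finally have "norm (?k z) \<le> \<delta> * (1 + norm x + norm y)" .
        then show "onorm (\<lambda>h. ?k z \<bullet> h) \<le> \<delta> * (1 + norm x + norm y)"
          using \<open>\<delta> > 0\<close>
          by (intro onorm_bound) (auto intro!: order_trans[OF Cauchy_Schwarz_ineq2] mult_right_mono)
      qed auto
      then show ?thesis by simp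
    qed
    show ?thesis
      by (rule tendsto_upperbound[OF _ eventually_mono[OF eventually_ge_at_top[of K] *]])
        (auto intro!: tendsto_intros val)
  qed
  then show ?thesis by (auto simp: eventually_sequentially)
qed

lemma proximal_step_eq:
  fixes f :: "'a::real_inner \<Rightarrow> real"
  assumes deriv: "(f has_derivative (\<lambda>h. g \<bullet> h)) (at y)" and "s > 0"
    and min: "\<And>\<eta>. f y + 1 / s * (1 / 2 * (norm (y - x))\<^sup>2) \<le> f \<eta> + 1 / s * (1 / 2 * (norm (\<eta> - x))\<^sup>2)"
  shows "y = x - s *\<^sub>R g"
proof -
  have "((\<lambda>\<eta>. f \<eta> + 1 / s * (1 / 2 * ((\<eta> - x) \<bullet> (\<eta> - x)))) has_derivative
      (\<lambda>h. g \<bullet> h + 1 / s * (1 / 2 * ((y - x) \<bullet> h + h \<bullet> (y - x))))) (at y)"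
    by (rule derivative_eq_intros deriv refl | simp)+
  also have "(\<lambda>h. g \<bullet> h + 1 / s * (1 / 2 * ((y - x) \<bullet> h + h \<bullet> (y - x))))
      = (\<lambda>h. (g + (1 / s) *\<^sub>R (y - x)) \<bullet> h)"
    by (simp add: fun_eq_iff inner_add_right inner_commute)
  finally have "(\<lambda>h. (g + (1 / s) *\<^sub>R (y - x)) \<bullet> h) = (\<lambda>h. 0)"
    by (rule has_derivative_local_min) (use min in \<open>auto simp: power2_norm_eq_inner\<close>)
  then have "g + (1 / s) *\<^sub>R (y - x) = 0" using inner_eq_zero_iff by metis
  then have "s *\<^sub>R (g + (1 / s) *\<^sub>R (y - x)) = 0" by simp
  then have "s *\<^sub>R g + (y - x) = 0" using \<open>s > 0\<close> by (simp add: scaleR_right_distrib)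
  then show ?thesis by (simp add: algebra_simps)
qed

text \<open>The excess \<open>X n\<close> of \<open>W n\<close> over \<open>e / 2\<close> shrinks by the factor \<open>1 + c / (n + 1)\<close> in each step, and the product of
these factors is at least \<open>1 + c \<Sum> 1 / (k + 1)\<close>, which diverges.\<close>

lemma harmonic_recursion_le:
  fixes W :: "nat \<Rightarrow> real"
  assumes "c > 0"
    and rec: "\<And>e. e > 0 \<Longrightarrow>
      \<forall>\<^sub>F n in sequentially. W (Suc n) \<le> W n + (e - c * W (Suc n)) / real (Suc n)"
    and "e > 0"
  shows "\<forall>\<^sub>F n in sequentially. W n < e"
proof -
  define X where "X n = max (W n - e / 2) 0" for n
  obtain M where M: "\<And>n. n \<ge> M \<Longrightarrow> W (Suc n) \<le> W n + (c * (e / 2) - c * W (Suc n)) / real (Suc n)"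
    using rec[of "c * (e / 2)"] \<open>c > 0\<close> \<open>e > 0\<close> by (auto simp: eventually_sequentially)
  have X_step: "(1 + c / real (Suc n)) * X (Suc n) \<le> X n" if "n \<ge> M" for n
  proof -
    have "(1 + c / real (Suc n)) * (W (Suc n) - e / 2) \<le> W n - e / 2"
      using M[OF that] by (simp add: field_simps)
    moreover have "1 + c / real (Suc n) > 0" using \<open>c > 0\<close> by (intro add_pos_pos) auto
    ultimately show ?thesis unfolding X_def by (auto simp: max_def)
  qed
  define P where "P n = 1 + c * (\<Sum>k=M..<n. 1 / real (Suc k))" for n
  have X_bound: "P n * X n \<le> X M" if "n \<ge> M" for n
    using that
  proof (induction n rule: dec_induct)
    case base
    show ?case by (simp add: P_def)
  next
    case (step n)
    have "P n \<ge> 1" using \<open>c > 0\<close> by (auto simp: P_def intro!: mult_nonneg_nonneg sum_nonneg)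
    have "P (Suc n) = P n + c / real (Suc n)" using step by (simp add: P_def algebra_simps)
    also have "\<dots> \<le> P n + P n * (c / real (Suc n))"
      using \<open>c > 0\<close> \<open>P n \<ge> 1\<close> by (simp add: mult_le_cancel_right1 divide_simps)
    finally have "P (Suc n) * X (Suc n) \<le> P n * ((1 + c / real (Suc n)) * X (Suc n))"
      using mult_right_mono[of "P (Suc n)" "P n + P n * (c / real (Suc n))" "X (Suc n)"]
      by (simp add: X_def algebra_simps)
    also have "\<dots> \<le> P n * X n" using X_step[OF step(1)] \<open>P n \<ge> 1\<close> by (intro mult_left_mono) auto
    finally show ?case using step by simp
  qed
  have "\<not> summable (\<lambda>k. 1 / real (Suc k))"
    using not_summable_harmonic[where 'a = real] summable_Suc_iff[of "\<lambda>n. inverse (real n)"]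
    by (simp add: divide_inverse)
  then have unbounded: "\<exists>n. (\<Sum>k<n. 1 / real (Suc k)) > B" for B
    using summableI_nonneg_bounded[of "\<lambda>k. 1 / real (Suc k)" B] by (meson divide_nonneg_nonneg not_le of_nat_0_le_iff zero_le_one)
  have "\<exists>n\<ge>M. P n > X M * 2 / e"
  proof -
    obtain n where n: "(\<Sum>k<n. 1 / real (Suc k)) > X M * 2 / e / c + (\<Sum>k<M. 1 / real (Suc k))"
      using unbounded by blast
    have "X M * 2 / e / c \<ge> 0" using \<open>c > 0\<close> \<open>e > 0\<close> by (simp add: X_def)
    with n have "(\<Sum>k<n. 1 / real (Suc k)) > (\<Sum>k<M. 1 / real (Suc k))" by linarith
    then have "n \<ge> M"
      using sum_mono2[of "{..<M}" "{..<n}" "\<lambda>k. 1 / real (Suc k)"] by (force simp: not_le[symmetric])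
    have "(\<Sum>k<M. 1 / real (Suc k)) + (\<Sum>k=M..<n. 1 / real (Suc k)) = (\<Sum>k<n. 1 / real (Suc k))"
      using sum.atLeastLessThan_concat[of 0 M n "\<lambda>k. 1 / real (Suc k)"] \<open>n \<ge> M\<close> by (simp add: atLeast0LessThan)
    with n have "(\<Sum>k=M..<n. 1 / real (Suc k)) > X M * 2 / e / c" by linarith
    then have "c * (\<Sum>k=M..<n. 1 / real (Suc k)) > X M * 2 / e"
      using \<open>c > 0\<close> by (metis mult.commute pos_divide_less_eq)
    then show ?thesis using \<open>n \<ge> M\<close> by (intro exI[of _ n]) (simp add: P_def)
  qed
  then obtain n0 where n0: "n0 \<ge> M" "P n0 > X M * 2 / e" by blast
  have "W n < e" if "n \<ge> n0" for n
  proof -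
    have "P n0 \<le> P n" unfolding P_def using that \<open>c > 0\<close> by (intro add_left_mono mult_left_mono sum_mono2) auto
    then have "X M < P n * (e / 2)" using n0 \<open>e > 0\<close> by (simp add: field_simps) (smt (verit) mult_left_mono)
    moreover have "P n * X n \<le> X M" using X_bound that n0 by simp
    ultimately have "P n * X n < P n * (e / 2)" by linarith
    moreover have "P n > 0" using \<open>c > 0\<close> by (auto simp: P_def intro!: add_pos_nonneg mult_nonneg_nonneg sum_nonneg)
    ultimately have "X n < e / 2" by simp
    moreover have "W n - e / 2 \<le> X n" by (simp add: X_def)
    ultimately show ?thesis by simp
  qed
  then show ?thesis by (auto simp: eventually_sequentially)
qed

lemma square_growth_bound:
  fixes a v R :: real
  assumes "a \<le> K * (R + v)\<^sup>2" "K \<ge> 0"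
  shows "a \<le> K * (2 * R\<^sup>2 + 2 * v\<^sup>2)"
proof -
  have "(R + v)\<^sup>2 \<le> 2 * R\<^sup>2 + 2 * v\<^sup>2" using zero_le_power2[of "R - v"] by (simp add: power2_eq_square algebra_simps)
  then show ?thesis using assms by (meson mult_left_mono order_trans)
qed

text \<open>The Lyapunov argument described at the beginning. Quadratic growth is asked of the averaged objective,
since a single batch may leave some directions of the parameter undetermined.\<close>

lemma incremental_proximal_convergence:
  fixes f :: "nat \<Rightarrow> 'a::euclidean_space \<Rightarrow> real" and g :: "nat \<Rightarrow> 'a \<Rightarrow> 'a"
  assumes deriv: "\<And>n x. (f n has_derivative (\<lambda>h. g n x \<bullet> h)) (at x)"
    and conv: "\<And>n x y. f n y \<ge> f n x + g n x \<bullet> (y - x)"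
    and growth: "\<And>n x. norm (g n x) \<le> G * (1 + norm x)"
    and grad: "\<And>\<delta>. \<delta> > 0 \<Longrightarrow>
      \<forall>\<^sub>F N in sequentially. \<forall>x. norm (cesaro (\<lambda>n. g n x) N - gbar x) \<le> \<delta> * (1 + norm x)"
    and val: "\<And>x. cesaro (\<lambda>n. f n x) \<longlonglongrightarrow> fbar x"
    and "m > 0" and opt: "\<And>x. fbar x \<ge> fbar xs + m * (norm (x - xs))\<^sup>2"
    and "a > 0"
    and step: "\<And>n. \<theta> (Suc n) = \<theta> n - (a / real (Suc n)) *\<^sub>R g n (\<theta> (Suc n))"
  shows "\<theta> \<longlonglongrightarrow> xs"
proof -
  define e where "e N x = (cesaro (\<lambda>n. f n x) N - fbar x) - (cesaro (\<lambda>n. f n xs) N - fbar xs)" for N x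
  define V where "V n = (norm (\<theta> n - xs))\<^sup>2" for n
  define W where "W n = V n + 2 * a * e n (\<theta> n)" for n
  define R where "R = 1 + norm xs"
  have "R \<ge> 1" by (simp add: R_def)
  have "G \<ge> 0" using order_trans[OF norm_ge_zero growth[of 0 0]] by simp
  have V0: "V n \<ge> 0" for n by (simp add: V_def)
  \<comment> \<open>The exact one-step inequality: convexity bounds the new distance, and the identity for \<open>f n\<close> in
    terms of consecutive averages turns its deviation into a telescoping difference.\<close>
  have W_step: "W (Suc n) \<le> W n + 2 * a * (e n (\<theta> (Suc n)) - e n (\<theta> n))
      - 2 * (a / real (Suc n)) * (m * V (Suc n)) - 2 * (a / real (Suc n)) * e n (\<theta> (Suc n))" for n
  proof -
    let ?x = "\<theta> (Suc n)" and ?s = "a / real (Suc n)"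
    have "\<theta> n - xs = (?x - xs) + ?s *\<^sub>R g n ?x" using step[of n] by (simp add: algebra_simps)
    then have "V n = (norm ((?x - xs) + ?s *\<^sub>R g n ?x))\<^sup>2"
      unfolding V_def by (rule arg_cong)
    also have "\<dots> = V (Suc n) + 2 * ?s * (g n ?x \<bullet> (?x - xs)) + (norm (?s *\<^sub>R g n ?x))\<^sup>2"
      unfolding V_def power2_norm_eq_inner
      by (simp only: inner_add_left inner_add_right inner_scaleR_left inner_scaleR_right inner_commute)
    finally have "V n \<ge> V (Suc n) + 2 * ?s * (g n ?x \<bullet> (?x - xs))" by simp
    moreover have "g n ?x \<bullet> (?x - xs) \<ge> f n ?x - f n xs"
      using conv[of n ?x xs] by (simp add: inner_diff_right)
    then have "2 * ?s * (g n ?x \<bullet> (?x - xs)) \<ge> 2 * ?s * (f n ?x - f n xs)"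
      using \<open>a > 0\<close> by (intro mult_left_mono) auto
    moreover have "?s * (f n ?x - f n xs) = ?s * (fbar ?x - fbar xs) + a * e (Suc n) ?x - a * e n ?x + ?s * e n ?x"
    proof -
      have c: "real n * cesaro (\<lambda>k. f k x) n = (\<Sum>k<n. f k x)" for x
        by (cases "n = 0") (simp_all add: cesaro_def)
      have "real (Suc n) * cesaro (\<lambda>k. f k x) (Suc n) = (\<Sum>k<n. f k x) + f n x" for x
        by (simp add: cesaro_def)
      then have d: "f n x = real (Suc n) * cesaro (\<lambda>k. f k x) (Suc n) - real n * cesaro (\<lambda>k. f k x) n" for x
        using c[of x] by simp
      have "f n ?x - f n xs = (fbar ?x - fbar xs) + real (Suc n) * e (Suc n) ?x - real n * e n ?x"
        unfolding d[of ?x] d[of xs] e_def by (simp add: algebra_simps)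
      then have "?s * (f n ?x - f n xs) = ?s * (fbar ?x - fbar xs)
          + (?s * real (Suc n)) * e (Suc n) ?x - (?s * real n) * e n ?x"
        by (simp only: distrib_left right_diff_distrib mult.assoc)
      moreover have "?s * real (Suc n) = a" "?s * real n = a - ?s" by (simp_all add: field_simps)
      ultimately show ?thesis by (simp only: left_diff_distrib)
    qed
    moreover have "?s * (fbar ?x - fbar xs) \<ge> ?s * (m * V (Suc n))"
      using opt[of ?x] \<open>a > 0\<close> by (intro mult_left_mono) (auto simp: V_def)
    ultimately show ?thesis unfolding W_def right_diff_distrib by linarith
  qed
  have dev: "\<forall>\<^sub>F n in sequentially. \<forall>x y. \<bar>e n x - e n y\<bar> \<le> \<delta> * (1 + norm x + norm y) * norm (x - y)"
    if "\<delta> > 0" for \<delta>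
  proof -
    have "e n x - e n y = (cesaro (\<lambda>k. f k x) n - fbar x) - (cesaro (\<lambda>k. f k y) n - fbar y)" for n x y
      by (simp add: e_def)
    then show ?thesis using averaged_deviation_lipschitz[OF deriv grad val that] by presburger
  qed
  have e_small: "\<bar>e n x\<bar> \<le> 2 * \<delta> * (R + norm (x - xs))\<^sup>2"
    if "\<forall>x y. \<bar>e n x - e n y\<bar> \<le> \<delta> * (1 + norm x + norm y) * norm (x - y)" "\<delta> > 0" for n x \<delta>
  proof -
    have "e n xs = 0" by (simp add: e_def)
    then have "\<bar>e n x\<bar> \<le> \<delta> * (1 + norm x + norm xs) * norm (x - xs)" using that(1)[rule_format, of x xs] by simp
    also have "\<dots> \<le> \<delta> * (2 * (R + norm (x - xs))) * (R + norm (x - xs))"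
    proof (intro mult_mono mult_left_mono)
      have "norm x \<le> norm xs + norm (x - xs)" by norm
      then show "1 + norm x + norm xs \<le> 2 * (R + norm (x - xs))" using norm_ge_zero[of "x - xs"] unfolding R_def by argo
    qed (use \<open>\<delta> > 0\<close> \<open>R \<ge> 1\<close> in auto)
    also have "\<dots> = 2 * \<delta> * (R + norm (x - xs))\<^sup>2" by (simp only: power2_eq_square mult_ac)
    finally show ?thesis .
  qed
  \<comment> \<open>The step is implicit, so its length is bounded in terms of the new iterate. As soon as
    \<open>a G \<le> n\<close> the old iterate is controlled by the new one as well.\<close>
  have drift: "\<forall>\<^sub>F n in sequentially. norm (\<theta> (Suc n) - \<theta> n) \<le> a / real (Suc n) * G * (R + norm (\<theta> (Suc n) - xs))
        \<and> 1 + norm (\<theta> (Suc n)) + norm (\<theta> n) \<le> 3 * (R + norm (\<theta> (Suc n) - xs))"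
  proof -
    obtain M :: nat where M: "real M > a * G" using reals_Archimedean2 by blast
    show ?thesis using eventually_ge_at_top[of M]
    proof eventually_elim
      case (elim n)
      let ?v = "norm (\<theta> (Suc n) - xs)"
      have x: "1 + norm (\<theta> (Suc n)) \<le> R + ?v"
      proof -
        have "norm (\<theta> (Suc n)) \<le> norm xs + ?v" by norm
        then show ?thesis by (simp add: R_def)
      qed
      have "\<theta> (Suc n) - \<theta> n = - ((a / real (Suc n)) *\<^sub>R g n (\<theta> (Suc n)))"
        by (subst step) simp
      then have "norm (\<theta> (Suc n) - \<theta> n) = a / real (Suc n) * norm (g n (\<theta> (Suc n)))"
        using \<open>a > 0\<close> by simp
      also have "\<dots> \<le> a / real (Suc n) * (G * (R + ?v))"
        using \<open>a > 0\<close> \<open>G \<ge> 0\<close> x growth[of n "\<theta> (Suc n)"]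
        by (intro mult_left_mono) (auto intro: order_trans mult_left_mono)
      finally have 1: "norm (\<theta> (Suc n) - \<theta> n) \<le> a / real (Suc n) * G * (R + ?v)" by (simp add: mult.assoc)
      have "a / real (Suc n) * G \<le> 1" using elim M by (simp add: divide_simps)
      then have "a / real (Suc n) * G * (R + ?v) \<le> 1 * (R + ?v)"
        using \<open>R \<ge> 1\<close> by (intro mult_right_mono) auto
      moreover have "norm (\<theta> n) \<le> norm (\<theta> (Suc n)) + norm (\<theta> (Suc n) - \<theta> n)" by norm
      ultimately have "1 + norm (\<theta> (Suc n)) + norm (\<theta> n) \<le> 3 * (R + ?v)" using 1 x norm_ge_zero[of "\<theta> (Suc n)"] by argo
      then show ?case using 1 by simp
    qed
  qed
  have WV: "\<forall>\<^sub>F n in sequentially. \<bar>W n - V n\<bar> \<le> \<epsilon> * (1 + V n)" if "\<epsilon> > 0" for \<epsilon>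
  proof -
    \<comment> \<open>The factor 8 collects 2 from \<open>W\<close>, 2 from \<open>e_small\<close> and 2 from squaring a sum.\<close>
    define \<delta> where "\<delta> = \<epsilon> / (8 * a * R\<^sup>2)"
    have \<delta>: "\<delta> > 0" using that \<open>a > 0\<close> \<open>R \<ge> 1\<close> by (simp add: \<delta>_def)
    show ?thesis using dev[OF \<delta>]
    proof eventually_elim
      case (elim n)
      have "\<bar>W n - V n\<bar> = 2 * a * \<bar>e n (\<theta> n)\<bar>" using \<open>a > 0\<close> by (simp add: W_def abs_mult)
      also have "\<bar>e n (\<theta> n)\<bar> \<le> 2 * \<delta> * (2 * R\<^sup>2 + 2 * V n)"
        unfolding V_def by (rule square_growth_bound[OF e_small[OF elim \<delta>]]) (use \<delta> in simp)
      also have "2 * R\<^sup>2 + 2 * V n \<le> 2 * R\<^sup>2 * (1 + V n)"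
        using V0[of n] \<open>R \<ge> 1\<close> by (simp add: algebra_simps mult_le_cancel_left1 one_le_power)
      also have "2 * a * (2 * \<delta> * (2 * R\<^sup>2 * (1 + V n))) = \<epsilon> * (1 + V n)"
        using \<open>a > 0\<close> \<open>R \<ge> 1\<close> by (simp add: \<delta>_def field_simps)
      finally show ?case using \<open>a > 0\<close> \<delta> by simp
    qed
  qed
  have W_rec: "\<forall>\<^sub>F n in sequentially. W (Suc n) \<le> W n + (\<epsilon> - (a * m / 2) * W (Suc n)) / real (Suc n)"
    if "\<epsilon> > 0" for \<epsilon>
  proof -
    \<comment> \<open>In units of \<open>a / (n + 1)\<close> and \<open>\<delta>\<close>, the drift of \<open>e n\<close> contributes \<open>6 a G\<close> and its value
      contributes 4, each times \<open>2 R\<^sup>2 (1 + V)\<close>.\<close>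
    define K where "K = 2 * (6 * a * G + 4) * R\<^sup>2"
    have "K > 0"
      unfolding K_def by (intro mult_pos_pos add_nonneg_pos) (use \<open>a > 0\<close> \<open>G \<ge> 0\<close> \<open>R \<ge> 1\<close> in auto)
    \<comment> \<open>\<open>\<gamma>\<close> is the relative gap allowed between \<open>W\<close> and \<open>V\<close>.\<close>
    define \<gamma> where "\<gamma> = min 1 (\<epsilon> / (2 * a * m))"
    have \<gamma>: "\<gamma> > 0" "\<gamma> \<le> 1" "a * m * \<gamma> \<le> \<epsilon> / 2"
    proof -
      show "\<gamma> > 0" "\<gamma> \<le> 1" using that \<open>a > 0\<close> \<open>m > 0\<close> by (simp_all add: \<gamma>_def)
      have "\<gamma> \<le> \<epsilon> / (2 * a * m)" by (simp add: \<gamma>_def)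
      then show "a * m * \<gamma> \<le> \<epsilon> / 2"
        using \<open>a > 0\<close> \<open>m > 0\<close> by (simp add: pos_le_divide_eq mult_ac)
    qed
    \<comment> \<open>With \<open>K \<delta> \<le> m\<close> the error consumes at most half of the decrease \<open>2 m V\<close>; the second bound makes
      its constant part at most \<open>\<epsilon> / 2\<close>.\<close>
    define \<delta> where "\<delta> = min (m / K) (\<epsilon> / (2 * a * K))"
    have \<delta>: "\<delta> > 0" "K * \<delta> \<le> m" "a * (K * \<delta>) \<le> \<epsilon> / 2"
    proof -
      show "\<delta> > 0" using that \<open>a > 0\<close> \<open>m > 0\<close> \<open>K > 0\<close> by (simp add: \<delta>_def)
      have "\<delta> \<le> m / K" "\<delta> \<le> \<epsilon> / (2 * a * K)" by (simp_all add: \<delta>_def)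
      then show "K * \<delta> \<le> m" "a * (K * \<delta>) \<le> \<epsilon> / 2"
        using \<open>a > 0\<close> \<open>K > 0\<close> by (simp_all add: pos_le_divide_eq mult_ac)
    qed
    have WV': "\<forall>\<^sub>F n in sequentially. \<bar>W (Suc n) - V (Suc n)\<bar> \<le> \<gamma> * (1 + V (Suc n))"
      using WV[OF \<gamma>(1)] eventually_sequentially_Suc[of "\<lambda>n. \<bar>W n - V n\<bar> \<le> \<gamma> * (1 + V n)"] by simp
    show ?thesis using dev[OF \<delta>(1)] drift WV'
    proof eventually_elim
      case (elim n)
      let ?v = "norm (\<theta> (Suc n) - xs)"
      define s where "s = a / real (Suc n)"
      have "s \<ge> 0" using \<open>a > 0\<close> by (simp add: s_def)
      have "\<bar>e n (\<theta> (Suc n)) - e n (\<theta> n)\<bar>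
          \<le> \<delta> * (1 + norm (\<theta> (Suc n)) + norm (\<theta> n)) * norm (\<theta> (Suc n) - \<theta> n)" using elim(1) by blast
      also have "\<dots> \<le> \<delta> * (3 * (R + ?v)) * (s * G * (R + ?v))"
        using elim(2)[folded s_def] \<delta>(1) \<open>R \<ge> 1\<close> by (intro mult_mono mult_left_mono) auto
      also have "\<dots> = 3 * \<delta> * s * G * (R + ?v)\<^sup>2" by (simp only: power2_eq_square mult_ac)
      finally have 1: "\<bar>e n (\<theta> (Suc n)) - e n (\<theta> n)\<bar> \<le> 3 * \<delta> * s * G * (2 * R\<^sup>2 + 2 * V (Suc n))"
        unfolding V_def
        by (rule square_growth_bound) (intro mult_nonneg_nonneg; use \<delta>(1) \<open>s \<ge> 0\<close> \<open>G \<ge> 0\<close> in simp)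
      have 2: "\<bar>e n (\<theta> (Suc n))\<bar> \<le> 2 * \<delta> * (2 * R\<^sup>2 + 2 * V (Suc n))"
        unfolding V_def by (rule square_growth_bound[OF e_small[OF elim(1) \<delta>(1)]]) (use \<delta> in simp)
      have lip_term: "2 * a * (e n (\<theta> (Suc n)) - e n (\<theta> n)) \<le> 2 * a * (3 * \<delta> * s * G * (2 * R\<^sup>2 + 2 * V (Suc n)))"
        using 1 \<open>a > 0\<close> by (intro mult_left_mono) auto
      have "- e n (\<theta> (Suc n)) \<le> 2 * \<delta> * (2 * R\<^sup>2 + 2 * V (Suc n))" using 2 by linarith
      from mult_left_mono[OF this, of "2 * s"]
      have value_term: "- (2 * s * e n (\<theta> (Suc n))) \<le> 2 * s * (2 * \<delta> * (2 * R\<^sup>2 + 2 * V (Suc n)))"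
        using \<open>s \<ge> 0\<close> by (simp only: mult_minus_right)
      have "W (Suc n) \<le> W n + s * ((6 * a * G + 4) * \<delta> * (2 * R\<^sup>2 + 2 * V (Suc n)) - 2 * m * V (Suc n))"
      proof -
        have eq: "s * ((6 * a * G + 4) * \<delta> * B - 2 * m * v) = 2 * a * (3 * \<delta> * s * G * B) + 2 * s * (2 * \<delta> * B) - 2 * s * (m * v)" for B v
          by (simp add: algebra_simps)
        show ?thesis
          using W_step[of n, folded s_def] lip_term value_term eq[of "2 * R\<^sup>2 + 2 * V (Suc n)" "V (Suc n)"]
          by linarith
      qed
      also have "\<dots> \<le> W n + s * (K * \<delta> - m * V (Suc n))"
      proof -
        have "2 * R\<^sup>2 + 2 * V (Suc n) \<le> 2 * R\<^sup>2 * (1 + V (Suc n))"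
          using V0[of "Suc n"] \<open>R \<ge> 1\<close> by (simp add: algebra_simps mult_le_cancel_left1 one_le_power)
        then have "(6 * a * G + 4) * \<delta> * (2 * R\<^sup>2 + 2 * V (Suc n)) \<le> (6 * a * G + 4) * \<delta> * (2 * R\<^sup>2 * (1 + V (Suc n)))"
          using \<open>a > 0\<close> \<open>G \<ge> 0\<close> \<delta>(1) by (intro mult_left_mono) auto
        also have "\<dots> = K * \<delta> * (1 + V (Suc n))" by (simp only: K_def mult_ac)
        also have "\<dots> = K * \<delta> + K * \<delta> * V (Suc n)" by (simp add: algebra_simps)
        also have "\<dots> \<le> K * \<delta> + m * V (Suc n)"
          using \<delta>(2) V0 by (intro add_left_mono mult_right_mono) auto
        finally show ?thesis using \<open>s \<ge> 0\<close> by (intro add_left_mono mult_left_mono) auto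
      qed
      also have "\<dots> = W n + (a * (K * \<delta>) - a * m * V (Suc n)) / real (Suc n)"
        by (simp add: s_def right_diff_distrib diff_divide_distrib mult.assoc)
      also have "\<dots> \<le> W n + (\<epsilon> - (a * m / 2) * W (Suc n)) / real (Suc n)"
      proof -
        have "W (Suc n) \<le> V (Suc n) + \<gamma> + \<gamma> * V (Suc n)" using elim(3) by (simp add: algebra_simps)
        also have "\<gamma> * V (Suc n) \<le> 1 * V (Suc n)" using \<gamma> V0 by (intro mult_right_mono) auto
        finally have "a * m / 2 * W (Suc n) \<le> a * m / 2 * (2 * V (Suc n) + \<gamma>)"
          using \<open>a > 0\<close> \<open>m > 0\<close> by (intro mult_left_mono) auto
        also have "\<dots> \<le> a * m * V (Suc n) + \<epsilon> / 2" using \<gamma>(3) that by (simp add: distrib_left)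
        finally show ?thesis using \<delta>(3) by (intro add_left_mono divide_right_mono) auto
      qed
      finally show ?case .
    qed
  qed
  have "V \<longlonglongrightarrow> 0"
  proof (rule tendstoI)
    fix \<epsilon> :: real assume "\<epsilon> > 0"
    define \<gamma> where "\<gamma> = min (1 / 2) (\<epsilon> / 4)"
    have \<gamma>: "\<gamma> > 0" "\<gamma> \<le> 1 / 2" "\<gamma> \<le> \<epsilon> / 4" using \<open>\<epsilon> > 0\<close> by (auto simp: \<gamma>_def)
    have "a * m / 2 > 0" using \<open>a > 0\<close> \<open>m > 0\<close> by simp
    from harmonic_recursion_le[OF this W_rec, of "\<epsilon> / 4"] \<open>\<epsilon> > 0\<close>
    have "\<forall>\<^sub>F n in sequentially. W n < \<epsilon> / 4" by simp
    then show "\<forall>\<^sub>F n in sequentially. dist (V n) 0 < \<epsilon>" using WV[OF \<gamma>(1)]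
    proof eventually_elim
      case (elim n)
      have "V n - \<gamma> - \<gamma> * V n \<le> W n" using elim(2) by (simp add: algebra_simps)
      moreover have "\<gamma> * V n \<le> 1 / 2 * V n" using \<gamma> V0 by (intro mult_right_mono) auto
      ultimately show ?case using elim(1) \<gamma>(3) V0[of n] by simp
    qed
  qed
  then have "(\<lambda>n. sqrt (V n)) \<longlonglongrightarrow> sqrt 0" by (rule tendsto_real_sqrt)
  then have "(\<lambda>n. norm (\<theta> n - xs)) \<longlonglongrightarrow> 0" by (simp add: V_def)
  then have "(\<lambda>n. \<theta> n - xs) \<longlonglongrightarrow> 0" by (rule tendsto_norm_zero_cancel)
  then show ?thesis by (rule LIM_zero_cancel)
qed

section \<open>Minimizers of strongly convex functions\<close>

text \<open>Convexity gives continuity, hence a lower bound on the unit ball, and strong convexity along rays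
propagates it to \<open>f x \<ge> f 0\<close> far out, so a minimizer exists in a ball. Quadratic growth around it is
strong convexity at the midpoint between the minimizer and \<open>x\<close>.\<close>

lemma strongly_convex_minimizer:
  fixes f :: "'a::euclidean_space \<Rightarrow> real"
  assumes "strongly_convex_on UNIV f"
  obtains xs m where "m > 0" "\<And>x. f x \<ge> f xs + m * (norm (x - xs))\<^sup>2"
proof -
  obtain m where m: "m > 0" and sc: "\<And>x y t. t \<in> {0..1} \<Longrightarrow>
      f ((1 - t) *\<^sub>R x + t *\<^sub>R y) \<le> (1 - t) * f x + t * f y - m / 2 * t * (1 - t) * (norm (x - y))\<^sup>2"
    using assms unfolding strongly_convex_on_def by auto
  have "convex_on UNIV f"
  proof (rule convex_onI)
    fix t :: real and x y :: 'a assume t: "0 < t" "t < 1"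
    then have "0 \<le> m / 2 * t * (1 - t) * (norm (x - y))\<^sup>2" using m by simp
    then show "f ((1 - t) *\<^sub>R x + t *\<^sub>R y) \<le> (1 - t) * f x + t * f y" using sc[of t x y] t by simp
  qed simp
  then have cont: "continuous_on UNIV f" by (intro convex_on_continuous) auto
  obtain z where z: "\<And>x. norm x \<le> 1 \<Longrightarrow> f z \<le> f x"
    using continuous_attains_inf[of "cball 0 1" f] continuous_on_subset[OF cont, of "cball 0 1"] by force
  \<comment> \<open>Beyond this radius the quadratic term of strong convexity dominates the drop \<open>f 0 - f z\<close>.\<close>
  define \<rho> where "\<rho> = 1 + 2 * (f 0 - f z) / m"
  have "f 0 \<ge> f z" using z[of 0] by simp
  then have "\<rho> \<ge> 1" using m by (simp add: \<rho>_def)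
  have far: "f x \<ge> f 0" if x: "norm x \<ge> \<rho>" for x
  proof -
    define n where "n = norm x"
    have n: "n \<ge> 1" "n > 0" using x \<open>\<rho> \<ge> 1\<close> by (auto simp: n_def)
    have "f z \<le> f ((1 - 1 / n) *\<^sub>R 0 + (1 / n) *\<^sub>R x)" by (rule z) (use n in \<open>simp add: n_def\<close>)
    also have "\<dots> \<le> (1 - 1 / n) * f 0 + 1 / n * f x - m / 2 * (1 / n) * (1 - 1 / n) * (norm (0 - x))\<^sup>2"
      using n by (intro sc) auto
    also have "norm (0 - x) = n" by (simp add: n_def)
    finally have "n * f z \<le> n * ((1 - 1 / n) * f 0 + 1 / n * f x - m / 2 * (1 / n) * (1 - 1 / n) * n\<^sup>2)"
      using n by (intro mult_left_mono) auto
    also have "\<dots> = n * f 0 - f 0 + f x - m / 2 * (n - 1) * n"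
      using n by (simp add: field_simps power2_eq_square)
    finally have "f x \<ge> f 0 + n * (m / 2 * (n - 1) - (f 0 - f z))" by (simp add: algebra_simps)
    moreover have "m / 2 * (n - 1) \<ge> f 0 - f z" using x m unfolding \<rho>_def n_def by (simp add: field_simps)
    ultimately show ?thesis using n by (smt (verit) mult_nonneg_nonneg)
  qed
  obtain xs where xs: "\<And>x. norm x \<le> \<rho> \<Longrightarrow> f xs \<le> f x"
    using continuous_attains_inf[of "cball 0 \<rho>" f] continuous_on_subset[OF cont, of "cball 0 \<rho>"] \<open>\<rho> \<ge> 1\<close>
    by force
  have min: "f xs \<le> f x" for x
    using xs[of x] xs[of 0] far[of x] \<open>\<rho> \<ge> 1\<close> by (cases "norm x \<le> \<rho>") auto
  have "f x \<ge> f xs + m / 4 * (norm (x - xs))\<^sup>2" for x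
  proof -
    have "f xs \<le> (1 - 1 / 2) * f x + 1 / 2 * f xs - m / 2 * (1 / 2) * (1 - 1 / 2) * (norm (x - xs))\<^sup>2"
      using order_trans[OF min sc[of "1 / 2" x xs]] by simp
    then show ?thesis by simp
  qed
  then show ?thesis using m by (intro that[of "m / 4" xs]) auto
qed

lemma strongly_convex_on_scale_add:
  fixes f h :: "'a::real_normed_vector \<Rightarrow> real"
  assumes f: "strongly_convex_on UNIV f" and "\<kappa> > 0"
    and h: "\<And>x y t. 0 \<le> t \<Longrightarrow> t \<le> 1 \<Longrightarrow> h ((1 - t) *\<^sub>R x + t *\<^sub>R y) \<le> (1 - t) * h x + t * h y"
  shows "strongly_convex_on UNIV (\<lambda>x. \<kappa> * f x + h x)"
proof -
  obtain m where "m > 0" and m: "\<And>x y t. t \<in> {0..1} \<Longrightarrow>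
      f ((1 - t) *\<^sub>R x + t *\<^sub>R y) \<le> (1 - t) * f x + t * f y - m / 2 * t * (1 - t) * (norm (x - y))\<^sup>2"
    using f unfolding strongly_convex_on_def by auto
  have "\<kappa> * f ((1 - t) *\<^sub>R x + t *\<^sub>R y) + h ((1 - t) *\<^sub>R x + t *\<^sub>R y)
      \<le> (1 - t) * (\<kappa> * f x + h x) + t * (\<kappa> * f y + h y) - (\<kappa> * m) / 2 * t * (1 - t) * (norm (x - y))\<^sup>2"
    if t: "t \<in> {0..1}" for x y t
  proof -
    have "\<kappa> * f ((1 - t) *\<^sub>R x + t *\<^sub>R y)
        \<le> \<kappa> * ((1 - t) * f x + t * f y - m / 2 * t * (1 - t) * (norm (x - y))\<^sup>2)"
      using m[OF t] \<open>\<kappa> > 0\<close> by (intro mult_left_mono) auto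
    then show ?thesis using h[of t x y] t by (simp add: algebra_simps)
  qed
  then show ?thesis
    unfolding strongly_convex_on_def using \<open>m > 0\<close> \<open>\<kappa> > 0\<close> by (intro conjI exI[of _ "\<kappa> * m"]) auto
qed

section \<open>Batches of losses with a homogeneous slope\<close>

text \<open>A finite net of the unit sphere and the common Lipschitz constant make the convergence uniform
there; homogeneity extends it to the whole space with an error proportional to the norm.\<close>

lemma homogeneous_uniform_limit:
  fixes A :: "nat \<Rightarrow> 'a::euclidean_space \<Rightarrow> 'b::real_normed_vector"
  assumes hom: "\<And>n t x. t \<ge> 0 \<Longrightarrow> A n (t *\<^sub>R x) = t *\<^sub>R A n x"
    and lip: "\<And>n x y. norm (A n x - A n y) \<le> L * norm (x - y)"
    and lim: "\<And>x. (\<lambda>n. A n x) \<longlonglongrightarrow> B x"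
    and "\<delta> > 0"
  shows "\<forall>\<^sub>F n in sequentially. \<forall>x. norm (A n x - B x) \<le> \<delta> * norm x"
proof -
  define M where "M = max L 1"
  have M: "M > 0" "L \<le> M" by (auto simp: M_def)
  have homB: "B (t *\<^sub>R x) = t *\<^sub>R B x" if "t \<ge> 0" for t x
  proof -
    have "(\<lambda>n. A n (t *\<^sub>R x)) \<longlonglongrightarrow> t *\<^sub>R B x" unfolding hom[OF that] by (intro tendsto_intros lim)
    then show ?thesis using lim LIMSEQ_unique by blast
  qed
  have lipA: "norm (A n x - A n y) \<le> M * norm (x - y)" for n x y
    using lip[of n x y] M(2) by (meson mult_right_mono norm_ge_zero order_trans)
  have lipB: "norm (B x - B y) \<le> M * norm (x - y)" for x y
    by (rule tendsto_upperbound[of "\<lambda>n. norm (A n x - A n y)" _ sequentially])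
      (auto intro!: tendsto_intros lim always_eventually lipA)
  define e where "e = \<delta> / (4 * M)"
  have "e > 0" using M \<open>\<delta> > 0\<close> by (simp add: e_def)
  have "compact (sphere (0::'a) 1)" by (rule compact_sphere)
  then obtain S where S: "finite S" "S \<subseteq> sphere (0::'a) 1" "sphere 0 1 \<subseteq> (\<Union>z\<in>S. ball z e)"
    using compactE_image[of "sphere (0::'a) 1" "sphere 0 1" "\<lambda>z. ball z e"] \<open>e > 0\<close>
    by (metis (no_types, lifting) UN_iff centre_in_ball open_ball subsetI)
  have "\<forall>\<^sub>F n in sequentially. \<forall>z\<in>S. norm (A n z - B z) < \<delta> / 2"
    using S(1)
  proof (rule eventually_ball_finite)
    show "\<forall>z\<in>S. \<forall>\<^sub>F n in sequentially. norm (A n z - B z) < \<delta> / 2"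
      using tendstoD[OF lim, of "\<delta> / 2"] \<open>\<delta> > 0\<close> by (auto simp: dist_norm)
  qed
  then show ?thesis
  proof eventually_elim
    case (elim n)
    have unit: "norm (A n x - B x) \<le> \<delta>" if "norm x = 1" for x
    proof -
      obtain z where z: "z \<in> S" "norm (x - z) < e"
        using subsetD[OF S(3), of x] \<open>norm x = 1\<close> by (auto simp: dist_norm norm_minus_commute[of x])
      have "norm (A n x - B x) \<le> norm (A n x - A n z) + norm (A n z - B z) + norm (B x - B z)"
        by norm
      also have "\<dots> \<le> M * norm (x - z) + \<delta> / 2 + M * norm (x - z)"
        using lipA[of n x z] lipB[of x z] elim z(1) by (intro add_mono) (auto intro: less_imp_le)
      also have "\<dots> \<le> M * e + \<delta> / 2 + M * e"
        using z(2) M by (intro add_mono mult_left_mono) auto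
      also have "\<dots> = \<delta>" using M by (simp add: e_def field_simps)
      finally show ?thesis .
    qed
    show ?case
    proof
      fix x
      show "norm (A n x - B x) \<le> \<delta> * norm x"
      proof (cases "x = 0")
        case True
        then show ?thesis using hom[of 0 n 0] homB[of 0 0] by simp
      next
        case False
        define w where "w = x /\<^sub>R norm x"
        have w: "norm w = 1" "x = norm x *\<^sub>R w" using False by (auto simp: w_def)
        have "A n x - B x = norm x *\<^sub>R (A n w - B w)"
          by (metis hom homB norm_ge_zero w(2) scaleR_right_diff_distrib)
        then show ?thesis
          using mult_right_mono[OF unit[OF w(1)] norm_ge_zero[of x]] by (simp add: mult.commute)
      qed
    qed
  qed
qed

text \<open>Scalar losses between their tangents and a parabola above them, with slope \<open>p'\<close>. The two bounds
give convexity and differentiability at once, also for the squared positive part, which is not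
twice differentiable. Homogeneity of the slope is what makes averaged gradients converge uniformly
relative to the size of the parameter.\<close>

locale homogeneous_loss =
  fixes p p' :: "real \<Rightarrow> real"
  assumes tangent_below: "p s + p' s * (t - s) \<le> p t"
    and parabola_above: "p t \<le> p s + p' s * (t - s) + (t - s)\<^sup>2"
    and slope_lipschitz: "\<bar>p' s - p' t\<bar> \<le> 2 * \<bar>s - t\<bar>"
    and slope_homogeneous: "t \<ge> 0 \<Longrightarrow> p' (t * s) = t * p' s"
begin

lemma slope_bound: "\<bar>p' s\<bar> \<le> 2 * \<bar>s\<bar>"
  using slope_lipschitz[of s 0] slope_homogeneous[of 0 0] by simp

lemma loss_bound: "\<bar>p s\<bar> \<le> \<bar>p 0\<bar> + s\<^sup>2"
  using tangent_below[of 0 s] parabola_above[of s 0] slope_homogeneous[of 0 0] zero_le_power2[of s]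
  by (simp add: abs_if)

lemma convex_combination:
  assumes "0 \<le> t" "t \<le> 1"
  shows "p ((1 - t) * a + t * b) \<le> (1 - t) * p a + t * p b"
proof -
  let ?z = "(1 - t) * a + t * b"
  have "(1 - t) * (p ?z + p' ?z * (a - ?z)) + t * (p ?z + p' ?z * (b - ?z)) \<le> (1 - t) * p a + t * p b"
    using assms by (intro add_mono mult_left_mono tangent_below) auto
  then show ?thesis by (simp add: algebra_simps)
qed

lemma loss_has_derivative: "(p has_real_derivative p' s) (at s)"
  unfolding has_field_derivative_def
proof (rule has_derivativeI)
  show "bounded_linear ((*) (p' s))" by (rule bounded_linear_mult_right)
  show "(\<lambda>t. (p t - p s - p' s * (t - s)) /\<^sub>R norm (t - s)) \<midarrow>s\<rightarrow> 0"
  proof (rule Lim_null_comparison)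
    show "\<forall>\<^sub>F t in at s. norm ((p t - p s - p' s * (t - s)) /\<^sub>R norm (t - s)) \<le> \<bar>t - s\<bar>"
    proof (rule eventually_at_filter[THEN iffD2], intro always_eventually allI impI)
      fix t assume "t \<noteq> s"
      have "\<bar>p t - p s - p' s * (t - s)\<bar> \<le> (t - s)\<^sup>2"
        using tangent_below[of s t] parabola_above[of t s] by simp
      then have "\<bar>p t - p s - p' s * (t - s)\<bar> \<le> \<bar>t - s\<bar> * \<bar>t - s\<bar>" by (simp add: power2_eq_square abs_mult[symmetric])
      then show "norm ((p t - p s - p' s * (t - s)) /\<^sub>R norm (t - s)) \<le> \<bar>t - s\<bar>"
        using \<open>t \<noteq> s\<close> by (simp add: divide_simps)
    qed
    show "(\<lambda>t. \<bar>t - s\<bar>) \<midarrow>s\<rightarrow> 0" by (auto intro!: tendsto_eq_intros)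
  qed
qed

definition batch_loss ::
  "(nat \<Rightarrow> nat) \<Rightarrow> (nat \<Rightarrow> real) \<Rightarrow> (nat \<Rightarrow> 'a::euclidean_space) \<Rightarrow> (nat \<Rightarrow> real) \<Rightarrow> nat \<Rightarrow> 'a \<Rightarrow> real" where
  "batch_loss T \<kappa> v c n \<theta> = \<kappa> n * batch_mean T (\<lambda>k. p (\<theta> \<bullet> v k + c k)) n"

definition batch_grad ::
  "(nat \<Rightarrow> nat) \<Rightarrow> (nat \<Rightarrow> real) \<Rightarrow> (nat \<Rightarrow> 'a::euclidean_space) \<Rightarrow> (nat \<Rightarrow> real) \<Rightarrow> nat \<Rightarrow> 'a \<Rightarrow> 'a" where
  "batch_grad T \<kappa> v c n \<theta> = \<kappa> n *\<^sub>R batch_mean T (\<lambda>k. p' (\<theta> \<bullet> v k + c k) *\<^sub>R v k) n"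

lemma batch_loss_has_derivative:
  "(batch_loss T \<kappa> v c n has_derivative (\<lambda>h. batch_grad T \<kappa> v c n \<theta> \<bullet> h)) (at \<theta>)"
proof -
  have "((\<lambda>\<theta>. p (\<theta> \<bullet> v k + c k)) has_derivative (\<lambda>h. p' (\<theta> \<bullet> v k + c k) * (h \<bullet> v k))) (at \<theta>)" for k
  proof -
    have "((\<lambda>\<theta>. \<theta> \<bullet> v k + c k) has_derivative (\<lambda>h. h \<bullet> v k)) (at \<theta>)"
      by (auto intro!: derivative_eq_intros)
    from DERIV_compose_FDERIV[OF loss_has_derivative this] show ?thesis by (simp add: mult.commute)
  qed
  then have "((\<lambda>\<theta>. \<kappa> n * batch_mean T (\<lambda>k. p (\<theta> \<bullet> v k + c k)) n) has_derivative
      (\<lambda>h. \<kappa> n * batch_mean T (\<lambda>k. p' (\<theta> \<bullet> v k + c k) * (h \<bullet> v k)) n)) (at \<theta>)"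
    unfolding batch_mean_def by (auto intro!: derivative_intros)
  moreover have "batch_grad T \<kappa> v c n \<theta> \<bullet> h = \<kappa> n * batch_mean T (\<lambda>k. p' (\<theta> \<bullet> v k + c k) * (h \<bullet> v k)) n" for h
    by (simp add: batch_grad_def batch_mean_def inner_sum_left inner_commute[of h])
  ultimately show ?thesis by (simp add: batch_loss_def[abs_def])
qed

lemma batch_loss_tangent:
  assumes "\<kappa> n \<ge> 0"
  shows "batch_loss T \<kappa> v c n \<theta> + batch_grad T \<kappa> v c n \<theta> \<bullet> (\<eta> - \<theta>) \<le> batch_loss T \<kappa> v c n \<eta>"
proof -
  have "p (\<theta> \<bullet> v k + c k) + (p' (\<theta> \<bullet> v k + c k) *\<^sub>R v k) \<bullet> (\<eta> - \<theta>) \<le> p (\<eta> \<bullet> v k + c k)" for k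
    using tangent_below[of "\<theta> \<bullet> v k + c k" "\<eta> \<bullet> v k + c k"]
    by (simp add: inner_diff_right inner_diff_left inner_commute)
  then have "(\<Sum>k = T n..<T (Suc n). p (\<theta> \<bullet> v k + c k)) + (\<Sum>k = T n..<T (Suc n). p' (\<theta> \<bullet> v k + c k) *\<^sub>R v k) \<bullet> (\<eta> - \<theta>)
      \<le> (\<Sum>k = T n..<T (Suc n). p (\<eta> \<bullet> v k + c k))"
    unfolding inner_sum_left sum.distrib[symmetric] by (intro sum_mono)
  then have "inverse (real (T (Suc n) - T n)) * ((\<Sum>k = T n..<T (Suc n). p (\<theta> \<bullet> v k + c k))
        + (\<Sum>k = T n..<T (Suc n). p' (\<theta> \<bullet> v k + c k) *\<^sub>R v k) \<bullet> (\<eta> - \<theta>))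
      \<le> inverse (real (T (Suc n) - T n)) * (\<Sum>k = T n..<T (Suc n). p (\<eta> \<bullet> v k + c k))"
    by (intro mult_left_mono) auto
  from mult_left_mono[OF this assms] show ?thesis
    by (simp add: batch_loss_def batch_grad_def batch_mean_def distrib_left)
qed

lemma sample_grad_bound:
  fixes w :: "'a::real_inner"
  assumes "norm w \<le> B" "\<bar>c\<bar> \<le> B"
  shows "norm (p' (\<theta> \<bullet> w + c) *\<^sub>R w) \<le> 2 * B\<^sup>2 * (1 + norm \<theta>)"
proof -
  have "B \<ge> 0" using assms(2) by simp
  have "\<bar>\<theta> \<bullet> w\<bar> \<le> norm \<theta> * B"
    using Cauchy_Schwarz_ineq2[of \<theta> w] assms(1) by (meson mult_left_mono norm_ge_zero order_trans)
  then have "\<bar>\<theta> \<bullet> w + c\<bar> \<le> norm \<theta> * B + B" using assms(2) by linarith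
  then have "\<bar>p' (\<theta> \<bullet> w + c)\<bar> \<le> 2 * (norm \<theta> * B + B)"
    by (intro order_trans[OF slope_bound] mult_left_mono) auto
  then have "norm (p' (\<theta> \<bullet> w + c) *\<^sub>R w) \<le> 2 * (norm \<theta> * B + B) * B"
    using assms(1) \<open>B \<ge> 0\<close> by (simp add: mult_mono)
  then show ?thesis by (simp add: power2_eq_square algebra_simps)
qed

lemma batch_grad_bound:
  assumes T: "strict_mono T" and "\<And>k. norm (v k) \<le> B" "\<And>k. \<bar>c k\<bar> \<le> B" "\<And>n. \<bar>\<kappa> n\<bar> \<le> K"
  shows "norm (batch_grad T \<kappa> v c n \<theta>) \<le> K * (2 * B\<^sup>2) * (1 + norm \<theta>)"
proof -
  have "norm (batch_mean T (\<lambda>k. p' (\<theta> \<bullet> v k + c k) *\<^sub>R v k) n) \<le> 2 * B\<^sup>2 * (1 + norm \<theta>)"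
    using T by (rule norm_batch_mean_le) (intro sample_grad_bound assms)
  moreover have "0 \<le> K" using assms(4)[of 0] by simp
  ultimately show ?thesis
    unfolding batch_grad_def norm_scaleR mult.assoc[of K] using assms(4)[of n]
    by (intro mult_mono) auto
qed

text \<open>The offsets \<open>c k\<close> destroy homogeneity in \<open>\<theta>\<close>. Treating the factor \<open>s\<close> in front of them as an additional
coordinate restores it, and \<open>(\<theta>, 1)\<close> has norm at most \<open>1 + norm \<theta>\<close>.\<close>

lemma batch_grad_averages:
  fixes v :: "nat \<Rightarrow> 'a::euclidean_space"
  assumes T: "T 0 = 0" "strict_mono T"
    and r: "(\<lambda>n. real (T (Suc n) - T n)) \<longlonglongrightarrow> r"
    and \<kappa>: "\<kappa> \<longlonglongrightarrow> \<kappa>'"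
    and v: "\<And>k. norm (v k) \<le> B" and c: "\<And>k. \<bar>c k\<bar> \<le> B"
    and conv: "\<And>\<theta> s. cesaro (\<lambda>k. p' (\<theta> \<bullet> v k + s * c k) *\<^sub>R v k) \<longlonglongrightarrow> \<Gamma> \<theta> s"
    and "\<delta> > 0"
  shows "\<forall>\<^sub>F N in sequentially. \<forall>\<theta>.
      norm (cesaro (\<lambda>n. batch_grad T \<kappa> v c n \<theta>) N - \<kappa>' *\<^sub>R \<Gamma> \<theta> 1) \<le> \<delta> * (1 + norm \<theta>)"
proof -
  define q where "q k z = p' (fst z \<bullet> v k + snd z * c k) *\<^sub>R v k" for k and z :: "'a \<times> real"
  define A where "A N z = cesaro (\<lambda>n. \<kappa> n *\<^sub>R batch_mean T (\<lambda>k. q k z) n) N" for N z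
  have "B \<ge> 0" using c[of 0] by simp
  obtain K where K: "\<And>n. \<bar>\<kappa> n\<bar> \<le> K"
    using convergent_imp_Bseq[of \<kappa>] \<kappa> unfolding convergent_def Bseq_def by auto
  have q_hom: "q k (t *\<^sub>R z) = t *\<^sub>R q k z" if "t \<ge> 0" for k t z
    using slope_homogeneous[OF that, of "fst z \<bullet> v k + snd z * c k"]
    by (simp add: q_def distrib_left mult.assoc)
  have q_lip: "norm (q k z - q k z') \<le> 4 * B\<^sup>2 * norm (z - z')" for k z z'
  proof -
    let ?s = "fst z \<bullet> v k + snd z * c k" and ?s' = "fst z' \<bullet> v k + snd z' * c k"
    have "?s - ?s' = (fst (z - z')) \<bullet> v k + snd (z - z') * c k"
      by (simp add: inner_diff_left left_diff_distrib)
    moreover have norm_parts: "norm (fst (z - z')) \<le> norm (z - z')" "norm (snd (z - z')) \<le> norm (z - z')"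
      using norm_fst_le[of "fst (z - z')" "snd (z - z')"] norm_snd_le[of "snd (z - z')" "fst (z - z')"]
      by (simp_all only: prod.collapse)
    moreover have "\<bar>(fst (z - z')) \<bullet> v k\<bar> \<le> norm (z - z') * B"
      by (rule order_trans[OF Cauchy_Schwarz_ineq2])
        (intro mult_mono norm_parts v; simp)
    moreover have "\<bar>snd (z - z') * c k\<bar> \<le> norm (z - z') * B"
      unfolding abs_mult using norm_parts(2) by (intro mult_mono c) auto
    ultimately have "\<bar>?s - ?s'\<bar> \<le> 2 * (norm (z - z') * B)" by linarith
    from mult_left_mono[OF this, of 2]
    have "\<bar>p' ?s - p' ?s'\<bar> \<le> 4 * (norm (z - z') * B)"
      by (intro order_trans[OF slope_lipschitz]) simp
    then have "\<bar>p' ?s - p' ?s'\<bar> * norm (v k) \<le> 4 * (norm (z - z') * B) * B"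
      using v[of k] \<open>B \<ge> 0\<close> by (intro mult_mono) auto
    then show ?thesis
      by (simp add: q_def scaleR_left_diff_distrib[symmetric] power2_eq_square mult_ac)
  qed
  have "\<forall>\<^sub>F N in sequentially. \<forall>z. norm (A N z - \<kappa>' *\<^sub>R \<Gamma> (fst z) (snd z)) \<le> \<delta> * norm z"
  proof (rule homogeneous_uniform_limit[where L = "K * (4 * B\<^sup>2)"])
    show "A N (t *\<^sub>R z) = t *\<^sub>R A N z" if "t \<ge> 0" for N t z
      by (simp add: A_def q_hom[OF that] batch_mean_scaleR cesaro_scaleR[symmetric] mult.commute)
    show "norm (A N z - A N z') \<le> K * (4 * B\<^sup>2) * norm (z - z')" for N z z'
    proof -
      have "norm (\<kappa> n *\<^sub>R batch_mean T (\<lambda>k. q k z - q k z') n) \<le> K * (4 * B\<^sup>2 * norm (z - z'))" for n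
        unfolding norm_scaleR using K[of n] norm_batch_mean_le[OF T(2) q_lip, where n = n]
        by (intro mult_mono) auto
      then have "norm (cesaro (\<lambda>n. \<kappa> n *\<^sub>R batch_mean T (\<lambda>k. q k z - q k z') n) N)
          \<le> K * (4 * B\<^sup>2 * norm (z - z'))" by (rule norm_cesaro_le)
      then show ?thesis
        by (simp add: A_def cesaro_diff[symmetric] scaleR_right_diff_distrib[symmetric]
            batch_mean_diff[symmetric] mult.assoc)
    qed
    show "(\<lambda>N. A N z) \<longlonglongrightarrow> \<kappa>' *\<^sub>R \<Gamma> (fst z) (snd z)" for z
    proof -
      have "norm (q k z) \<le> 4 * B\<^sup>2 * norm z" for k using q_lip[of k z 0] q_hom[of 0 k 0] by simp
      from cesaro_batch_mean[OF T r \<kappa> this] conv[of "fst z" "snd z"]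
      show ?thesis by (simp add: A_def[abs_def] q_def)
    qed
  qed fact
  then show ?thesis
  proof eventually_elim
    case (elim N)
    show ?case
    proof
      fix \<theta>
      have "norm (cesaro (\<lambda>n. batch_grad T \<kappa> v c n \<theta>) N - \<kappa>' *\<^sub>R \<Gamma> \<theta> 1) \<le> \<delta> * norm (\<theta>, 1::real)"
        using elim[rule_format, of "(\<theta>, 1)"] by (simp add: A_def q_def batch_grad_def)
      also have "norm (\<theta>, 1::real) \<le> 1 + norm \<theta>"
        using norm_Pair_le[of \<theta> "1::real"] by simp
      finally show "norm (cesaro (\<lambda>n. batch_grad T \<kappa> v c n \<theta>) N - \<kappa>' *\<^sub>R \<Gamma> \<theta> 1) \<le> \<delta> * (1 + norm \<theta>)"
        using \<open>\<delta> > 0\<close> by simp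
    qed
  qed
qed

lemma batch_loss_averages:
  fixes v :: "nat \<Rightarrow> 'a::euclidean_space"
  assumes T: "T 0 = 0" "strict_mono T"
    and r: "(\<lambda>n. real (T (Suc n) - T n)) \<longlonglongrightarrow> r"
    and \<kappa>: "\<kappa> \<longlonglongrightarrow> \<kappa>'"
    and v: "\<And>k. norm (v k) \<le> B" and c: "\<And>k. \<bar>c k\<bar> \<le> B"
    and conv: "cesaro (\<lambda>k. p (\<theta> \<bullet> v k + c k)) \<longlonglongrightarrow> l"
  shows "cesaro (\<lambda>n. batch_loss T \<kappa> v c n \<theta>) \<longlonglongrightarrow> \<kappa>' * l"
proof -
  have "norm (p (\<theta> \<bullet> v k + c k)) \<le> \<bar>p 0\<bar> + (norm \<theta> * B + B)\<^sup>2" for k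
  proof -
    have "\<bar>\<theta> \<bullet> v k\<bar> \<le> norm \<theta> * B"
      using Cauchy_Schwarz_ineq2[of \<theta> "v k"] v[of k] by (meson mult_left_mono norm_ge_zero order_trans)
    then have "\<bar>\<theta> \<bullet> v k + c k\<bar> \<le> norm \<theta> * B + B" using c[of k] by linarith
    then have "(\<theta> \<bullet> v k + c k)\<^sup>2 \<le> (norm \<theta> * B + B)\<^sup>2" by (metis abs_ge_zero power2_abs power_mono)
    then show ?thesis using loss_bound[of "\<theta> \<bullet> v k + c k"] by simp
  qed
  from cesaro_batch_mean[OF T r \<kappa> this conv] show ?thesis by (simp add: batch_loss_def)
qed

end

interpretation square: homogeneous_loss "\<lambda>s. s\<^sup>2" "\<lambda>s. 2 * s"
proof
  fix s t :: real
  show "s\<^sup>2 + 2 * s * (t - s) \<le> t\<^sup>2"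
    using zero_le_power2[of "t - s"] by (simp add: power2_eq_square algebra_simps)
qed (auto simp: power2_eq_square algebra_simps abs_if)

interpretation positive_part: homogeneous_loss "\<lambda>s. (max s 0)\<^sup>2" "\<lambda>s. 2 * max s 0"
proof
  fix s t :: real
  show "(max s 0)\<^sup>2 + 2 * max s 0 * (t - s) \<le> (max t 0)\<^sup>2"
  proof -
    have "max s 0 * (t - s) \<le> max s 0 * (max t 0 - max s 0)"
      by (auto simp: max_def intro!: mult_left_mono)
    then show ?thesis
      using zero_le_power2[of "max t 0 - max s 0"] by (simp add: power2_eq_square algebra_simps)
  qed
  show "(max t 0)\<^sup>2 \<le> (max s 0)\<^sup>2 + 2 * max s 0 * (t - s) + (t - s)\<^sup>2"
  proof -
    \<comment> \<open>Monotonicity of the positive part, from \<open>t \<le> max s 0 + (t - s)\<close>.\<close>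
    have "(max t 0)\<^sup>2 \<le> (max (max s 0 + (t - s)) 0)\<^sup>2" by (intro power_mono) (auto simp: max_def)
    also have "\<dots> \<le> (max s 0 + (t - s))\<^sup>2" by (simp add: max_def)
    finally show ?thesis by (simp add: power2_eq_square algebra_simps)
  qed
  show "\<bar>2 * max s 0 - 2 * max t 0\<bar> \<le> 2 * \<bar>s - t\<bar>" by (auto simp: max_def abs_if)
  show "2 * max (t * s) 0 = t * (2 * max s 0)" if "t \<ge> 0"
    using that by (simp add: max_mult_distrib_left)
qed

section \<open>Consistency of the batch recursion\<close>

lemma averaged_gradient_sum:
  fixes g h :: "nat \<Rightarrow> 'a::real_normed_vector \<Rightarrow> 'b::real_normed_vector"
  assumes g: "\<And>\<delta>. \<delta> > 0 \<Longrightarrow> \<forall>\<^sub>F N in sequentially. \<forall>x. norm (cesaro (\<lambda>n. g n x) N - gbar x) \<le> \<delta> * (1 + norm x)"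
    and h: "\<And>\<delta>. \<delta> > 0 \<Longrightarrow> \<forall>\<^sub>F N in sequentially. \<forall>x. norm (cesaro (\<lambda>n. h n x) N - hbar x) \<le> \<delta> * (1 + norm x)"
    and "\<delta> > 0"
  shows "\<forall>\<^sub>F N in sequentially. \<forall>x.
      norm (cesaro (\<lambda>n. b + g n x + h n x) N - (b + gbar x + hbar x)) \<le> \<delta> * (1 + norm x)"
proof -
  have "\<delta> / 2 > 0" using \<open>\<delta> > 0\<close> by simp
  show ?thesis using g[OF \<open>\<delta> / 2 > 0\<close>] h[OF \<open>\<delta> / 2 > 0\<close>] eventually_gt_at_top[of 0]
  proof eventually_elim
    case (elim N)
    show ?case
    proof
      fix x
      have "cesaro (\<lambda>n. b + g n x + h n x) N - (b + gbar x + hbar x)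
          = (cesaro (\<lambda>n. g n x) N - gbar x) + (cesaro (\<lambda>n. h n x) N - hbar x)"
        using elim(3) by (simp add: cesaro_add cesaro_const)
      also have "norm \<dots> \<le> \<delta> / 2 * (1 + norm x) + \<delta> / 2 * (1 + norm x)"
        using elim by (intro norm_triangle_mono) auto
      finally show "norm (cesaro (\<lambda>n. b + g n x + h n x) N - (b + gbar x + hbar x)) \<le> \<delta> * (1 + norm x)"
        by (simp add: field_simps)
    qed
  qed
qed

theorem proposition2p4:
  fixes F :: "'x::polish_space \<times> 'u::polish_space \<Rightarrow> 'x"
    and \<phi> :: "'x \<times> (real^'p) \<Rightarrow> 'u"
    and H :: "real^'p \<Rightarrow> real^'p"
    and c :: "'x \<times> 'u \<Rightarrow> real"
    and xe :: 'x and ue :: 'u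
    and x :: "nat \<Rightarrow> 'x" and u :: "nat \<Rightarrow> 'u" and \<xi> :: "nat \<Rightarrow> real^'p"
    and \<omega> :: "('x \<times> 'u \<times> (real^'p)) measure"
    and \<mu> :: "'x measure"
    and \<psi>J :: "'x \<Rightarrow> real^'d" and \<psi> :: "'x \<times> 'u \<Rightarrow> real^'d"
    and J :: "real^'d \<Rightarrow> 'x \<Rightarrow> real" and Q :: "real^'d \<Rightarrow> 'x \<times> 'u \<Rightarrow> real"
    and T :: "nat \<Rightarrow> nat"
    and \<kappa>\<epsilon> \<kappa>p \<alpha> :: "nat \<Rightarrow> real"
    and r \<kappa>\<epsilon>_lim \<kappa>p_lim :: real
    and \<theta> :: "nat \<Rightarrow> real^'d"
  assumes equilibrium: "xe = F (xe, ue)"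
    and cost_nonneg: "\<And>z. c z \<ge> 0"
    and cost_equilibrium: "c (xe, ue) = 0"
    and dynamics_continuous: "continuous_on UNIV F" "continuous_on UNIV \<phi>" "continuous_on UNIV H"
    and data: "closed_loop F \<phi> H x u \<xi>"
    and exploration_bounded: "bounded (range \<xi>)"
    and data_bounded: "bounded (range (joint_process x u \<xi>))"
    and ergodic: "uniquely_ergodic F \<phi> H \<omega>"
    and T: "T 0 = 0" "strict_mono T"
    and \<kappa>_pos: "\<And>n. \<kappa>\<epsilon> n > 0" "\<And>n. \<kappa>p n > 0"
    and \<mu>_sets: "sets \<mu> = sets borel"
    and continuous: "continuous_on UNIV \<psi>J" "continuous_on UNIV \<psi>" "continuous_on UNIV c"
    and \<psi>J_integrable: "integrable \<mu> \<psi>J"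
    and \<psi>J_equilibrium: "\<psi>J xe = 0"
    and J_linear: "\<And>\<eta> y. J \<eta> y = \<eta> \<bullet> \<psi>J y"
    and Q_linear: "\<And>\<eta> z. Q \<eta> z = \<eta> \<bullet> \<psi> z"
    and strongly_convex: "strongly_convex_on UNIV (mean_bellman_loss \<omega> F J Q c)"
    and \<alpha>1_pos: "\<alpha> 1 > 0"
    and \<alpha>: "\<And>n. n \<ge> 1 \<Longrightarrow> \<alpha> n = \<alpha> 1 / real n"
    and r_lim: "(\<lambda>n. real (T (Suc n) - T n)) \<longlonglongrightarrow> r"
    and \<kappa>\<epsilon>_lim: "\<kappa>\<epsilon> \<longlonglongrightarrow> \<kappa>\<epsilon>_lim" "\<kappa>\<epsilon>_lim > 0"
    and \<kappa>p_lim: "\<kappa>p \<longlonglongrightarrow> \<kappa>p_lim"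
    and recursion:
      "\<And>n. is_arg_min (batch_objective \<mu> J Q c x u T \<kappa>\<epsilon> \<kappa>p \<alpha> n (\<theta> n)) (\<lambda>_. True) (\<theta> (Suc n))"
  shows "\<exists>\<theta>_opt.
    (\<forall>\<eta>. is_arg_min (limit_objective \<mu> \<omega> F J Q c \<kappa>\<epsilon>_lim \<kappa>p_lim) (\<lambda>_. True) \<eta>
            \<longleftrightarrow> \<eta> = \<theta>_opt) \<and>
    \<theta> \<longlonglongrightarrow> \<theta>_opt"
proof -
  \<comment> \<open>In the steady state both losses depend on the state \<open>z\<close> of the joint process through the features
    \<open>v\<close>, \<open>w\<close> and the cost \<open>q\<close>: the residuals are \<open>\<eta> \<bullet> v z + q z\<close> and \<open>\<eta> \<bullet> w z\<close>.\<close>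
  define \<Phi> where "\<Phi> = joint_process x u \<xi>"
  define I where "I g = (\<integral>z. g z \<partial>\<omega>)" for g :: "'x \<times> 'u \<times> (real^'p) \<Rightarrow> real"
  define b where "b = (\<integral>y. \<psi>J y \<partial>\<mu>)"
  define v where "v z = \<psi>J (F (fst z, fst (snd z))) - \<psi> (fst z, fst (snd z))" for z :: "'x \<times> 'u \<times> (real^'p)"
  define w where "w z = \<psi>J (fst z) - \<psi> (fst z, fst (snd z))" for z :: "'x \<times> 'u \<times> (real^'p)"
  define q where "q z = c (fst z, fst (snd z))" for z :: "'x \<times> 'u \<times> (real^'p)"
  define f where "f n \<eta> = - (\<eta> \<bullet> b) + square.batch_loss T \<kappa>\<epsilon> (\<lambda>k. v (\<Phi> k)) (\<lambda>k. q (\<Phi> k)) n \<eta>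
      + positive_part.batch_loss T \<kappa>p (\<lambda>k. w (\<Phi> k)) (\<lambda>_. 0) n \<eta>" for n \<eta>
  define g where "g n \<eta> = - b + square.batch_grad T \<kappa>\<epsilon> (\<lambda>k. v (\<Phi> k)) (\<lambda>k. q (\<Phi> k)) n \<eta>
      + positive_part.batch_grad T \<kappa>p (\<lambda>k. w (\<Phi> k)) (\<lambda>_. 0) n \<eta>" for n \<eta>
  define fbar where "fbar = limit_objective \<mu> \<omega> F J Q c \<kappa>\<epsilon>_lim \<kappa>p_lim"

  have erg: "empirical_mean \<Phi> h \<longlonglongrightarrow> I h" if "continuous_on UNIV h" for h
    using ergodic data that unfolding uniquely_ergodic_def ergodic_measure_def I_def \<Phi>_def by blast
  have cont_F: "continuous_on UNIV (\<lambda>z :: 'x \<times> 'u \<times> (real^'p). F (fst z, fst (snd z)))"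
    by (rule continuous_on_compose2[OF dynamics_continuous(1)]) (auto intro!: continuous_intros)
  have cont_\<psi>: "continuous_on UNIV (\<lambda>z :: 'x \<times> 'u \<times> (real^'p). \<psi> (fst z, fst (snd z)))"
    by (rule continuous_on_compose2[OF continuous(2)]) (auto intro!: continuous_intros)
  have v: "continuous_on UNIV v" unfolding v_def
    by (intro continuous_on_diff continuous_on_compose2[OF continuous(1) cont_F] cont_\<psi>) auto
  have w: "continuous_on UNIV w" unfolding w_def
    by (intro continuous_on_diff continuous_on_compose2[OF continuous(1) continuous_on_fst] cont_\<psi> continuous_on_id) auto
  have q: "continuous_on UNIV q" unfolding q_def
    by (rule continuous_on_compose2[OF continuous(3)]) (auto intro!: continuous_intros)

  obtain B1 B2 B3 where "\<And>k. norm (v (\<Phi> k)) \<le> B1" "\<And>k. norm (w (\<Phi> k)) \<le> B2" "\<And>k. norm (q (\<Phi> k)) \<le> B3"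
    using ergodic_observable_bounded[OF erg v] ergodic_observable_bounded[OF erg w]
      ergodic_observable_bounded[OF erg q] by metis
  then have "\<exists>B\<ge>0. \<forall>k. norm (v (\<Phi> k)) \<le> B \<and> norm (w (\<Phi> k)) \<le> B \<and> \<bar>q (\<Phi> k)\<bar> \<le> B"
    by (intro exI[of _ "max 0 (max B1 (max B2 B3))"]) (auto simp: le_max_iff_disj)
  then obtain B where "B \<ge> 0" and B: "\<And>k. norm (v (\<Phi> k)) \<le> B" "\<And>k. norm (w (\<Phi> k)) \<le> B" "\<And>k. \<bar>q (\<Phi> k)\<bar> \<le> B"
    by blast
  obtain K1 K2 where "\<And>n. \<bar>\<kappa>\<epsilon> n\<bar> \<le> K1" "\<And>n. \<bar>\<kappa>p n\<bar> \<le> K2"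
    using convergent_imp_Bseq[of \<kappa>\<epsilon>] convergent_imp_Bseq[of \<kappa>p] \<kappa>\<epsilon>_lim(1) \<kappa>p_lim
    unfolding convergent_def Bseq_def by auto
  then have K: "\<bar>\<kappa>\<epsilon> n\<bar> \<le> max K1 K2" "\<bar>\<kappa>p n\<bar> \<le> max K1 K2" for n by (auto simp: le_max_iff_disj)
  define K where "K = max K1 K2"

  have J_mean: "(\<integral>y. J \<eta> y \<partial>\<mu>) = \<eta> \<bullet> b" for \<eta>
    unfolding J_linear b_def using \<psi>J_integrable by simp
  have bellman: "mean_bellman_loss \<omega> F J Q c \<eta> = I (\<lambda>z. (\<eta> \<bullet> v z + q z)\<^sup>2)" for \<eta>
    unfolding mean_bellman_loss_def I_def v_def q_def J_linear Q_linear
    by (rule Bochner_Integration.integral_cong) (auto simp: inner_diff_right algebra_simps)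
  have constraint: "mean_constraint_loss \<omega> J Q \<eta> = I (\<lambda>z. (max (\<eta> \<bullet> w z + 0) 0)\<^sup>2)" for \<eta>
    unfolding mean_constraint_loss_def I_def w_def J_linear Q_linear
    by (rule Bochner_Integration.integral_cong) (auto simp: inner_diff_right)
  have fbar: "fbar \<eta> = - (\<eta> \<bullet> b) + \<kappa>\<epsilon>_lim * mean_bellman_loss \<omega> F J Q c \<eta> + \<kappa>p_lim * mean_constraint_loss \<omega> J Q \<eta>" for \<eta>
    by (simp add: fbar_def limit_objective_def J_mean)
  have x_Suc: "x (Suc k) = F (x k, u k)" for k using data by (simp add: closed_loop_def)
  have objective: "batch_objective \<mu> J Q c x u T \<kappa>\<epsilon> \<kappa>p \<alpha> n \<zeta> \<eta>
      = f n \<eta> + 1 / \<alpha> (Suc n) * (1 / 2 * (norm (\<eta> - \<zeta>))\<^sup>2)" for n \<eta> \<zeta>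
  proof -
    have "- Q \<eta> (x k, u k) + c (x k, u k) + J \<eta> (x (Suc k)) = \<eta> \<bullet> v (\<Phi> k) + q (\<Phi> k)" for k
      by (simp add: v_def q_def \<Phi>_def joint_process_def J_linear Q_linear x_Suc inner_diff_right)
    moreover have "J \<eta> (x k) - Q \<eta> (x k, u k) = \<eta> \<bullet> w (\<Phi> k) + 0" for k
      by (simp add: w_def \<Phi>_def joint_process_def J_linear Q_linear inner_diff_right)
    ultimately show ?thesis
      unfolding batch_objective_def f_def J_mean batch_bellman_loss_def batch_constraint_loss_def
        square.batch_loss_def positive_part.batch_loss_def batch_mean_def real_scaleR_def inverse_eq_divide
      by presburger
  qed

  have mean_sq: "cesaro (\<lambda>k. (\<eta> \<bullet> v (\<Phi> k) + q (\<Phi> k))\<^sup>2) \<longlonglongrightarrow> mean_bellman_loss \<omega> F J Q c \<eta>" for \<eta>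
    unfolding bellman by (rule ergodic_cesaro_real[OF erg], assumption) (intro continuous_intros v q)
  have mean_pp: "cesaro (\<lambda>k. (max (\<eta> \<bullet> w (\<Phi> k) + 0) 0)\<^sup>2) \<longlonglongrightarrow> mean_constraint_loss \<omega> J Q \<eta>" for \<eta>
    unfolding constraint by (rule ergodic_cesaro_real[OF erg], assumption) (intro continuous_intros w)
  \<comment> \<open>Limits of the averaged sample gradients; \<open>s\<close> scales the offset, as in \<open>batch_grad_averages\<close>.\<close>
  define \<Gamma>v where "\<Gamma>v \<eta> s = (SOME l. cesaro (\<lambda>k. (2 * (\<eta> \<bullet> v (\<Phi> k) + s * q (\<Phi> k))) *\<^sub>R v (\<Phi> k)) \<longlonglongrightarrow> l)" for \<eta> s
  have \<Gamma>v: "cesaro (\<lambda>k. (2 * (\<eta> \<bullet> v (\<Phi> k) + s * q (\<Phi> k))) *\<^sub>R v (\<Phi> k)) \<longlonglongrightarrow> \<Gamma>v \<eta> s" for \<eta> s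
    unfolding \<Gamma>v_def
    by (rule someI_ex, rule ergodic_cesaro_convergent[OF erg], assumption) (intro continuous_intros v q)
  define \<Gamma>w where "\<Gamma>w \<eta> s = (SOME l. cesaro (\<lambda>k. (2 * max (\<eta> \<bullet> w (\<Phi> k) + s * 0) 0) *\<^sub>R w (\<Phi> k)) \<longlonglongrightarrow> l)"
    for \<eta> and s :: real
  have \<Gamma>w: "cesaro (\<lambda>k. (2 * max (\<eta> \<bullet> w (\<Phi> k) + s * 0) 0) *\<^sub>R w (\<Phi> k)) \<longlonglongrightarrow> \<Gamma>w \<eta> s" for \<eta> and s :: real
    unfolding \<Gamma>w_def
    by (rule someI_ex, rule ergodic_cesaro_convergent[OF erg], assumption) (intro continuous_intros w)

  have "\<kappa>p_lim \<ge> 0" by (rule LIMSEQ_le_const[OF \<kappa>p_lim]) (use \<kappa>_pos(2) in \<open>auto intro: less_imp_le\<close>)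
  have "strongly_convex_on UNIV (\<lambda>\<eta>. \<kappa>\<epsilon>_lim * mean_bellman_loss \<omega> F J Q c \<eta>
      + (- (\<eta> \<bullet> b) + \<kappa>p_lim * mean_constraint_loss \<omega> J Q \<eta>))"
  proof (rule strongly_convex_on_scale_add[OF strongly_convex \<kappa>\<epsilon>_lim(2)])
    fix \<eta> \<zeta> :: "real^'d" and t :: real assume t: "0 \<le> t" "t \<le> 1"
    let ?p = "\<lambda>s :: real. (max s 0)\<^sup>2"
    have "mean_constraint_loss \<omega> J Q ((1 - t) *\<^sub>R \<eta> + t *\<^sub>R \<zeta>)
        \<le> (1 - t) * mean_constraint_loss \<omega> J Q \<eta> + t * mean_constraint_loss \<omega> J Q \<zeta>"
    \<comment> \<open>The constraint loss is convex as the limit of averages of convex functions.\<close>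
    proof (rule LIMSEQ_le[OF mean_pp tendsto_add[OF tendsto_mult_left[OF mean_pp] tendsto_mult_left[OF mean_pp]]],
        intro exI allI impI)
      fix N
      have "?p (((1 - t) *\<^sub>R \<eta> + t *\<^sub>R \<zeta>) \<bullet> w (\<Phi> k) + 0)
          \<le> (1 - t) * ?p (\<eta> \<bullet> w (\<Phi> k) + 0) + t * ?p (\<zeta> \<bullet> w (\<Phi> k) + 0)" for k
        using positive_part.convex_combination[OF t, of "\<eta> \<bullet> w (\<Phi> k)" "\<zeta> \<bullet> w (\<Phi> k)"]
        by (simp add: inner_add_left)
      then have "(\<Sum>k<N. ?p (((1 - t) *\<^sub>R \<eta> + t *\<^sub>R \<zeta>) \<bullet> w (\<Phi> k) + 0))
          \<le> (1 - t) * (\<Sum>k<N. ?p (\<eta> \<bullet> w (\<Phi> k) + 0)) + t * (\<Sum>k<N. ?p (\<zeta> \<bullet> w (\<Phi> k) + 0))"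
        unfolding sum_distrib_left sum.distrib[symmetric] by (intro sum_mono)
      from mult_left_mono[OF this, of "inverse (real N)"]
      show "cesaro (\<lambda>k. ?p (((1 - t) *\<^sub>R \<eta> + t *\<^sub>R \<zeta>) \<bullet> w (\<Phi> k) + 0)) N
          \<le> (1 - t) * cesaro (\<lambda>k. ?p (\<eta> \<bullet> w (\<Phi> k) + 0)) N + t * cesaro (\<lambda>k. ?p (\<zeta> \<bullet> w (\<Phi> k) + 0)) N"
        by (simp add: cesaro_def distrib_left mult.left_commute)
    qed
    from mult_left_mono[OF this \<open>\<kappa>p_lim \<ge> 0\<close>]
    show "- (((1 - t) *\<^sub>R \<eta> + t *\<^sub>R \<zeta>) \<bullet> b) + \<kappa>p_lim * mean_constraint_loss \<omega> J Q ((1 - t) *\<^sub>R \<eta> + t *\<^sub>R \<zeta>)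
        \<le> (1 - t) * (- (\<eta> \<bullet> b) + \<kappa>p_lim * mean_constraint_loss \<omega> J Q \<eta>)
          + t * (- (\<zeta> \<bullet> b) + \<kappa>p_lim * mean_constraint_loss \<omega> J Q \<zeta>)"
      by (simp add: inner_add_left algebra_simps)
  qed
  moreover have "fbar = (\<lambda>\<eta>. \<kappa>\<epsilon>_lim * mean_bellman_loss \<omega> F J Q c \<eta>
      + (- (\<eta> \<bullet> b) + \<kappa>p_lim * mean_constraint_loss \<omega> J Q \<eta>))"
    by (simp add: fun_eq_iff fbar)
  ultimately have "strongly_convex_on UNIV fbar" by simp
  then obtain \<theta>_opt m where "m > 0"
    and opt: "\<And>\<eta>. fbar \<eta> \<ge> fbar \<theta>_opt + m * (norm (\<eta> - \<theta>_opt))\<^sup>2"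
    by (rule strongly_convex_minimizer) blast

  have deriv: "(f n has_derivative (\<lambda>h. g n \<eta> \<bullet> h)) (at \<eta>)" for n \<eta>
  proof -
    have "(f n has_derivative (\<lambda>h. - (h \<bullet> b)
        + square.batch_grad T \<kappa>\<epsilon> (\<lambda>k. v (\<Phi> k)) (\<lambda>k. q (\<Phi> k)) n \<eta> \<bullet> h
        + positive_part.batch_grad T \<kappa>p (\<lambda>k. w (\<Phi> k)) (\<lambda>_. 0) n \<eta> \<bullet> h)) (at \<eta>)"
      unfolding f_def
      by (intro has_derivative_add has_derivative_minus has_derivative_inner_left has_derivative_ident
          square.batch_loss_has_derivative positive_part.batch_loss_has_derivative)
    then show ?thesis by (simp add: g_def inner_add_left inner_diff_left inner_commute[of b])
  qed
  have "\<theta> \<longlonglongrightarrow> \<theta>_opt"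
  proof (rule incremental_proximal_convergence[where f = f and g = g and fbar = fbar and a = "\<alpha> 1"
        and m = m and G = "norm b + 4 * (K * B\<^sup>2)"
        and gbar = "\<lambda>\<eta>. - b + \<kappa>\<epsilon>_lim *\<^sub>R \<Gamma>v \<eta> 1 + \<kappa>p_lim *\<^sub>R \<Gamma>w \<eta> 1"])
    show "(f n has_derivative (\<lambda>h. g n \<eta> \<bullet> h)) (at \<eta>)" for n \<eta> by (rule deriv)
    show "f n \<eta> + g n \<eta> \<bullet> (\<zeta> - \<eta>) \<le> f n \<zeta>" for n \<eta> \<zeta>
    proof -
      have "(- b) \<bullet> (\<zeta> - \<eta>) = - (\<zeta> \<bullet> b) + \<eta> \<bullet> b" by (simp add: inner_diff_right inner_commute)
      then show ?thesis
        using square.batch_loss_tangent[of \<kappa>\<epsilon> n T "\<lambda>k. v (\<Phi> k)" "\<lambda>k. q (\<Phi> k)" \<eta> \<zeta>]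
          positive_part.batch_loss_tangent[of \<kappa>p n T "\<lambda>k. w (\<Phi> k)" "\<lambda>_. 0" \<eta> \<zeta>] \<kappa>_pos[of n]
        unfolding f_def g_def inner_add_left by linarith
    qed
    show "norm (g n \<eta>) \<le> (norm b + 4 * (K * B\<^sup>2)) * (1 + norm \<eta>)" for n \<eta>
    proof -
      have "norm (square.batch_grad T \<kappa>\<epsilon> (\<lambda>k. v (\<Phi> k)) (\<lambda>k. q (\<Phi> k)) n \<eta>) \<le> K * (2 * B\<^sup>2) * (1 + norm \<eta>)"
        unfolding K_def by (intro square.batch_grad_bound T(2) B K)
      moreover have "norm (positive_part.batch_grad T \<kappa>p (\<lambda>k. w (\<Phi> k)) (\<lambda>_. 0) n \<eta>) \<le> K * (2 * B\<^sup>2) * (1 + norm \<eta>)"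
        unfolding K_def by (intro positive_part.batch_grad_bound T(2) B K) (use \<open>B \<ge> 0\<close> in simp)
      moreover have "norm b \<le> norm b * (1 + norm \<eta>)" by (simp add: mult_le_cancel_left1)
      moreover have "norm (- b + y + z) \<le> norm b + norm y + norm z" for y z by norm
      ultimately have "norm (g n \<eta>) \<le> norm b * (1 + norm \<eta>) + K * (2 * B\<^sup>2) * (1 + norm \<eta>) + K * (2 * B\<^sup>2) * (1 + norm \<eta>)"
        unfolding g_def by (meson add_mono order_trans)
      also have "\<dots> = (norm b + 4 * (K * B\<^sup>2)) * (1 + norm \<eta>)" by (simp add: algebra_simps)
      finally show ?thesis .
    qed
    show "\<forall>\<^sub>F N in sequentially. \<forall>\<eta>. norm (cesaro (\<lambda>n. g n \<eta>) N
        - (- b + \<kappa>\<epsilon>_lim *\<^sub>R \<Gamma>v \<eta> 1 + \<kappa>p_lim *\<^sub>R \<Gamma>w \<eta> 1)) \<le> \<delta> * (1 + norm \<eta>)" if "\<delta> > 0" for \<delta>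
      unfolding g_def
    proof (rule averaged_gradient_sum[OF _ _ that])
      show "\<forall>\<^sub>F N in sequentially. \<forall>\<eta>. norm (cesaro (\<lambda>n. square.batch_grad T \<kappa>\<epsilon> (\<lambda>k. v (\<Phi> k)) (\<lambda>k. q (\<Phi> k)) n \<eta>) N
          - \<kappa>\<epsilon>_lim *\<^sub>R \<Gamma>v \<eta> 1) \<le> \<delta> * (1 + norm \<eta>)" if "\<delta> > 0" for \<delta>
        by (rule square.batch_grad_averages[OF T r_lim \<kappa>\<epsilon>_lim(1) B(1) B(3) \<Gamma>v that])
      show "\<forall>\<^sub>F N in sequentially. \<forall>\<eta>. norm (cesaro (\<lambda>n. positive_part.batch_grad T \<kappa>p (\<lambda>k. w (\<Phi> k)) (\<lambda>_. 0) n \<eta>) N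
          - \<kappa>p_lim *\<^sub>R \<Gamma>w \<eta> 1) \<le> \<delta> * (1 + norm \<eta>)" if "\<delta> > 0" for \<delta>
        by (rule positive_part.batch_grad_averages[OF T r_lim \<kappa>p_lim B(2) _ \<Gamma>w that]) (use \<open>B \<ge> 0\<close> in simp)
    qed
    show "cesaro (\<lambda>n. f n \<eta>) \<longlonglongrightarrow> fbar \<eta>" for \<eta>
    proof -
      have "cesaro (\<lambda>n. positive_part.batch_loss T \<kappa>p (\<lambda>k. w (\<Phi> k)) (\<lambda>_. 0) n \<eta>)
          \<longlonglongrightarrow> \<kappa>p_lim * mean_constraint_loss \<omega> J Q \<eta>"
        by (rule positive_part.batch_loss_averages[OF T r_lim \<kappa>p_lim B(2) _ mean_pp]) (use \<open>B \<ge> 0\<close> in simp)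
      then show ?thesis
        unfolding f_def fbar cesaro_add
        by (intro tendsto_add cesaro_tendsto[OF tendsto_const]
            square.batch_loss_averages[OF T r_lim \<kappa>\<epsilon>_lim(1) B(1) B(3) mean_sq])
    qed
    show "m > 0" by fact
    show "fbar \<theta>_opt + m * (norm (\<eta> - \<theta>_opt))\<^sup>2 \<le> fbar \<eta>" for \<eta> by (rule opt)
    show "\<alpha> 1 > 0" by fact
    show "\<theta> (Suc n) = \<theta> n - (\<alpha> 1 / real (Suc n)) *\<^sub>R g n (\<theta> (Suc n))" for n
    proof (rule proximal_step_eq[OF deriv])
      show "\<alpha> 1 / real (Suc n) > 0" using \<alpha>1_pos by simp
      show "f n (\<theta> (Suc n)) + 1 / (\<alpha> 1 / real (Suc n)) * (1 / 2 * (norm (\<theta> (Suc n) - \<theta> n))\<^sup>2)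
          \<le> f n \<eta> + 1 / (\<alpha> 1 / real (Suc n)) * (1 / 2 * (norm (\<eta> - \<theta> n))\<^sup>2)" for \<eta>
        using recursion[of n] \<alpha>[of "Suc n"] unfolding is_arg_min_linorder objective by auto
    qed
  qed
  moreover have "is_arg_min fbar (\<lambda>_. True) \<eta> \<longleftrightarrow> \<eta> = \<theta>_opt" for \<eta>
  proof
    assume "is_arg_min fbar (\<lambda>_. True) \<eta>"
    then have "m * (norm (\<eta> - \<theta>_opt))\<^sup>2 \<le> 0"
      using opt[of \<eta>] unfolding is_arg_min_linorder by (smt (verit))
    then show "\<eta> = \<theta>_opt" using \<open>m > 0\<close> by (simp add: mult_le_0_iff)
  next
    assume "\<eta> = \<theta>_opt"
    moreover have "fbar \<theta>_opt \<le> fbar \<zeta>" for \<zeta>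
    proof -
      have "0 \<le> m * (norm (\<zeta> - \<theta>_opt))\<^sup>2" using \<open>m > 0\<close> by simp
      then show ?thesis using opt[of \<zeta>] by linarith
    qed
    ultimately show "is_arg_min fbar (\<lambda>_. True) \<eta>" unfolding is_arg_min_linorder by simp
  qed
  ultimately show ?thesis unfolding fbar_def by blast
qed

end
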